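(* Let $0\le m\le N-1$, let $\lambda\in\mathbb{N}_0^{N,+}$ and $E\in\mathcal{Y}_0$ with $\lfloor\lambda,E\rfloor$ row-strict, and let $p^a=p^a_{\lambda,E}$ be the antisymmetric polynomial in $\mathcal{M}(\lambda,E)$ (so $\boldsymbol{T}_ip^a=-p^a$ for $1\le i<N$). Let $E_0=\{N-m,N-m+1,\dots,N\}$ and $$z=\big(z_1,z_2,\dots,z_{N-m-1},t^{-m},\dots,t^{-2},t^{-1},1\big).$$ Then $$p^a(z;\theta)=\prod_{1\le i<j\le N-m-1}(tz_i-z_j)\prod_{k=1}^{N-m-1}\big(t^{m+1}z_k-1\big)\,p_0(z_1,\dots,z_{N-m-1})\,\tau_{E_0}(\theta),$$ where $p_0$ is a polynomial that is $\mathcal{S}_{N-m-1}$-symmetric (invariant under permutations of $z_1,\dots,z_{N-m-1}$).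
   Context: Base. $N\ge2$; $K$ is an extension field of $\mathbb{Q}(q,t)$ with $q,t$ algebraically independent (generic parameters). $\theta_1,\dots,\theta_N$ anti-commute ($\theta_i^2=0$, $\theta_i\theta_j=-\theta_j\theta_i$). For $E=\{i_1<\dots<i_k\}\subset\{1,\dots,N\}$ put $\phi_E=\theta_{i_1}\cdots\theta_{i_k}$, $E^C=\{1,\dots,N\}\setminus E$, $\operatorname{inv}(E)=\#\{(i,j)\in E\times E^C: i<j\}$. $\mathcal{P}_m=\operatorname{span}_K\{\phi_E:\#E=m\}$. For $1\le i<N$ the linear operator $T_i$ is: $T_i\phi_E=-\phi_E$ if $i,i+1\in E$; $t\phi_E$ if $i,i+1\notin E$; $\phi_{s_iE}$ if $i\in E,i+1\notin E$; $(t-1)\phi_E+t\phi_{s_iE}$ if $i\notin E,i+1\in E$, where $s_i$ is the transposition $(i,i+1)$. These satisfy the braid relations and $(T_i-t)(T_i+1)=0$. $\omega_N=1$, $\omega_i=t^{-1}T_i\omega_{i+1}T_i$. $D=\sum_{i=1}^N t^{i-1}\partial_i$ with $\partial_i\phi_E=(-1)^{\#\{j\in E:j<i\}}\phi_{E\setminus\{i\}}$ if $i\in E$, and $0$ otherwise. $\psi_E=D\phi_E$, $\mathcal{P}_{m,0}=\mathcal{P}_m\cap\ker D$. Labels. $\mathcal{Y}_0=\{E:\#E=m+1,\ N\in E\}$. For $E\in\mathcal{Y}_0$ with $E=\{i_1<\dots<i_{m+1}=N\}$, $E^C=\{j_1<\dots<j_{N-m-1}\}$, $Y_E$ is the hook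 tableau of shape $(N-m,1^m)$ with $Y_E[k,1]=i_{m+2-k}$ ($1\le k\le m+1$), $Y_E[1,k]=j_{N-m+1-k}$ ($2\le k\le N-m$). The content is $c(i,E)=b-a$ if $Y_E[a,b]=i$. $\tau_E$ is the unique element of $\mathcal{P}_{m,0}$ with $\omega_i\tau_E=t^{c(i,E)}\tau_E$ for all $i$ and $\tau_E-t^{\operatorname{inv}(E)}\psi_E\in\operatorname{span}\{\psi_F:F\in\mathcal{Y}_0,\operatorname{inv}(F)<\operatorname{inv}(E)\}$ (so $\tau_{E_0}=D\phi_{E_0}$). Macdonald polynomials. $x_1,\dots,x_N$ are commuting variables (commuting with the $\theta_i$); $s\mathcal{P}_{m,0}=K[x]\otimes\mathcal{P}_{m,0}$. For $1\le i<N$, $\boldsymbol{T}_ip(x;\theta)=(1-t)x_{i+1}\frac{p(x;\theta)-p(xs_i;\theta)}{x_i-x_{i+1}}+T_ip(xs_i;\theta)$, where $xs_i$ is $x$ with $x_i,x_{i+1}$ exchanged and $T_i$ acts on $\theta$. $\boldsymbol{w}p(x;\theta)=T_{N-1}\cdots T_1\,p(qx_N,x_1,\dots,x_{N-1};\theta)$ and $\xi_i=t^{i-N}\boldsymbol{T}_i\cdots\boldsymbol{T}_{N-1}\boldsymbol{w}\boldsymbol{T}_1^{-1}\cdots\boldsymbol{T}_{i-1}^{-1}$ (pairwise commuting). $\mathbb{N}_0^{N,+}$ is the set of nonincreasing $\lambda\in\mathbb{N}_0^N$; $\alpha^+$ is the nonincreasing rearrangement of $\alpha$. $r_\alpha(i)=\#\{j:\alpha_j>\alpha_i\}+\#\{j\le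 i:\alpha_j=\alpha_i\}$, a permutation; if $r_\alpha=s_{i_1}\cdots s_{i_k}$ is a shortest expression, $R_\alpha=(T_{i_1}\cdots T_{i_k})^{-1}$. For $\alpha\in\mathbb{N}_0^N,E\in\mathcal{Y}_0$, $M_{\alpha,E}$ (nonsymmetric Macdonald superpolynomial; existence is known) is the unique element of $s\mathcal{P}_{m,0}$ with $\xi_iM_{\alpha,E}=q^{\alpha_i}t^{c(r_\alpha(i),E)}M_{\alpha,E}$ for all $i$ and with coefficient of $x^\alpha$ equal to $t^{\sum_i\alpha_i^+(N-i+c(i,E))}q^{\sum_i\binom{\alpha_i}{2}}R_\alpha(\tau_E)$. Antisymmetric polynomial. $\lfloor\alpha,E\rfloor$ is the tableau obtained from $Y_E$ by replacing each entry $i$ by $\alpha_i^+$. $\mathcal{M}(\lambda,E)=\operatorname{span}\{M_{\beta,F}:\lfloor\beta,F\rfloor=\lfloor\lambda,E\rfloor\}\subset s\mathcal{P}_{m,0}$. Row-strict means that the entries in row 1 are strictly monotone (pairwise distinct). $E_S$ is the set $F\in\mathcal{Y}_0$ with $\lfloor\lambda,F\rfloor=\lfloor\lambda,E\rfloor$ for which $\operatorname{inv}(F)$ is maximal. $p^a_{\lambda,E}$ is the unique element of $\mathcal{M}(\lambda,E)$ with $\boldsymbol{T}_ip^a_{\lambda,E}=-p^a_{\lambda,E}$ for $1\le i<N$ and coefficient of $M_{\lambda,E_S}$ equal to $1$. $p^a(z;\theta)$ denotes $p^a$ evaluated at $x=z$. *)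

theory Defs
  imports
    "HOL-Library.Poly_Mapping"
    "HOL-Library.FuncSet"
    "HOL-Combinatorics.Permutations"
    "HOL-Computational_Algebra.Polynomial"
begin

section \<open>Generic parameters\<close>

text \<open>
  The base field \<open>K\<close> is a type of class \<open>field_char_0\<close>. It is an extension of the rational
  function field in \<open>q\<close> and \<open>t\<close> exactly when \<open>q, t\<close> satisfy no nontrivial polynomial relation over
  the rationals. The bivariate polynomial is a polynomial in \<open>t\<close> with coefficients in
  the polynomials in \<open>q\<close>.
\<close>

definition alg_independent2 :: "'k::field_char_0 \<Rightarrow> 'k \<Rightarrow> bool" where
  "alg_independent2 q t \<longleftrightarrow>
     (\<forall>P :: rat poly poly.
        poly (map_poly (\<lambda>p. poly (map_poly of_rat p) q) P) t = 0 \<longrightarrow> P = 0)"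


section \<open>Free modules with finitely supported coefficients\<close>

definition smul :: "'r::comm_ring_1 \<Rightarrow> ('a \<Rightarrow>\<^sub>0 'r) \<Rightarrow> ('a \<Rightarrow>\<^sub>0 'r)" where
  "smul c v = Poly_Mapping.map ((*) c) v"

lemma lookup_smul: "Poly_Mapping.lookup (smul c v) a = c * Poly_Mapping.lookup v a"
  by (simp add: smul_def map.rep_eq when_def)

definition lin_ext :: "('a \<Rightarrow> 'b \<Rightarrow>\<^sub>0 'r::comm_ring_1) \<Rightarrow> ('a \<Rightarrow>\<^sub>0 'r) \<Rightarrow> ('b \<Rightarrow>\<^sub>0 'r)" where
  "lin_ext f v = (\<Sum>a\<in>Poly_Mapping.keys v. smul (Poly_Mapping.lookup v a) (f a))"


section \<open>Polynomials in commuting variables\<close>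

type_synonym 'k pol = "(nat \<Rightarrow>\<^sub>0 nat) \<Rightarrow>\<^sub>0 'k"

definition Pconst :: "'k::comm_ring_1 \<Rightarrow> 'k pol" where
  "Pconst c = Poly_Mapping.single 0 c"

definition X :: "nat \<Rightarrow> 'k::comm_ring_1 pol" where
  "X i = Poly_Mapping.single (Poly_Mapping.single i 1) 1"

definition pol_in :: "nat set \<Rightarrow> 'k::comm_ring_1 pol \<Rightarrow> bool" where
  "pol_in V p \<longleftrightarrow> (\<forall>\<mu>\<in>Poly_Mapping.keys p. Poly_Mapping.keys \<mu> \<subseteq> V)"

text \<open>The \<open>K\<close>-algebra homomorphism that sends the variable \<open>X j\<close> to \<open>\<sigma> j\<close>.\<close>

definition psubst :: "(nat \<Rightarrow> 'k::comm_ring_1 pol) \<Rightarrow> 'k pol \<Rightarrow> 'k pol" where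
  "psubst \<sigma> p = (\<Sum>\<mu>\<in>Poly_Mapping.keys p.
     Pconst (Poly_Mapping.lookup p \<mu>) * (\<Prod>j\<in>Poly_Mapping.keys \<mu>. \<sigma> j ^ Poly_Mapping.lookup \<mu> j))"

definition pswap :: "nat \<Rightarrow> 'k::comm_ring_1 pol \<Rightarrow> 'k pol" where
  "pswap i = psubst (\<lambda>j. X (transpose i (Suc i) j))"

text \<open>The quotient \<open>(p(x) - p(x s\<^sub>i)) / (x\<^sub>i - x\<^bsub>i+1\<^esub>)\<close>, which is again a polynomial.\<close>

definition divdiff :: "nat \<Rightarrow> 'k::field pol \<Rightarrow> 'k pol" where
  "divdiff i p = (THE r. (X i - X (Suc i)) * r = p - pswap i p)"

definition sympol :: "nat \<Rightarrow> 'k::comm_ring_1 pol \<Rightarrow> bool" where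
  "sympol n p \<longleftrightarrow> (\<forall>\<pi>. \<pi> permutes {1..n} \<longrightarrow> psubst (\<lambda>j. X (\<pi> j)) p = p)"


section \<open>Fermionic polynomials\<close>

text \<open>
  An element \<open>\<Sum>\<^sub>E c\<^sub>E \<phi>\<^sub>E\<close> is represented by its coefficients \<open>c\<^sub>E\<close> with respect to the basis of the
  monomials \<open>\<phi>\<^sub>E\<close>. The coefficients lie in \<open>K\<close> for fermionic polynomials, and in the polynomial
  ring \<open>'k pol\<close> for superpolynomials. The operators acting on \<open>\<theta>\<close> are therefore defined over an
  arbitrary commutative ring, so that they extend coefficientwise to superpolynomials.
\<close>

type_synonym 'r ferm = "nat set \<Rightarrow>\<^sub>0 'r"
type_synonym 'k super = "'k pol ferm"

definition phi :: "nat set \<Rightarrow> 'r::comm_ring_1 ferm" where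
  "phi E = Poly_Mapping.single E 1"

definition T_theta :: "'r::comm_ring_1 \<Rightarrow> nat \<Rightarrow> 'r ferm \<Rightarrow> 'r ferm" where
  "T_theta t i = lin_ext (\<lambda>E.
     if i \<in> E \<and> Suc i \<in> E then - phi E
     else if i \<notin> E \<and> Suc i \<notin> E then smul t (phi E)
     else if i \<in> E then phi (transpose i (Suc i) ` E)
     else smul (t - 1) (phi E) + smul t (phi (transpose i (Suc i) ` E)))"

definition partial :: "nat \<Rightarrow> 'r::comm_ring_1 ferm \<Rightarrow> 'r ferm" where
  "partial i = lin_ext (\<lambda>E.
     if i \<in> E then smul ((-1) ^ card {j\<in>E. j < i}) (phi (E - {i})) else 0)"

definition D_op :: "nat \<Rightarrow> 'r::comm_ring_1 \<Rightarrow> 'r ferm \<Rightarrow> 'r ferm" where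
  "D_op N t v = (\<Sum>i=1..N. smul (t ^ (i - 1)) (partial i v))"

definition psi :: "nat \<Rightarrow> 'r::comm_ring_1 \<Rightarrow> nat set \<Rightarrow> 'r ferm" where
  "psi N t E = D_op N t (phi E)"

text \<open>\<open>omega_down N t d\<close> is \<open>\<omega>\<^bsub>N-d\<^esub>\<close>.\<close>

primrec omega_down :: "nat \<Rightarrow> 'k::field \<Rightarrow> nat \<Rightarrow> 'k ferm \<Rightarrow> 'k ferm" where
  "omega_down N t 0 = id"
| "omega_down N t (Suc d) =
     (\<lambda>v. smul (inverse t)
        (T_theta t (N - Suc d) (omega_down N t d (T_theta t (N - Suc d) v))))"

definition omega :: "nat \<Rightarrow> 'k::field \<Rightarrow> nat \<Rightarrow> 'k ferm \<Rightarrow> 'k ferm" where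
  "omega N t i = omega_down N t (N - i)"

global_interpretation ferm: vector_space "smul :: 'k::field \<Rightarrow> 'k ferm \<Rightarrow> 'k ferm"
  by unfold_locales
    (auto intro!: poly_mapping_eqI simp: lookup_smul lookup_add algebra_simps)

definition P_space :: "nat \<Rightarrow> nat \<Rightarrow> 'k::field ferm set" where
  "P_space N m = ferm.span {phi E | E. E \<subseteq> {1..N} \<and> card E = m}"

definition P0_space :: "nat \<Rightarrow> nat \<Rightarrow> 'k::field \<Rightarrow> 'k ferm set" where
  "P0_space N m t = P_space N m \<inter> {v. D_op N t v = 0}"


section \<open>Hook tableaux and the basis \<open>\<tau>\<^sub>E\<close>\<close>

definition inv_num :: "nat \<Rightarrow> nat set \<Rightarrow> nat" where
  "inv_num N E = card {(i, j). i \<in> E \<and> j \<in> {1..N} - E \<and> i < j}"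

definition Y0 :: "nat \<Rightarrow> nat \<Rightarrow> nat set set" where
  "Y0 N m = {E. E \<subseteq> {1..N} \<and> card E = m + 1 \<and> N \<in> E}"

definition hook_cells :: "nat \<Rightarrow> nat \<Rightarrow> (nat \<times> nat) set" where
  "hook_cells N m = {(k, 1) | k. 1 \<le> k \<and> k \<le> m + 1} \<union> {(1, k) | k. 2 \<le> k \<and> k \<le> N - m}"

text \<open>
  The entries are \<open>Y\<^sub>E[k,1] = i\<^bsub>m+2-k\<^esub>\<close> and \<open>Y\<^sub>E[1,k] = j\<^bsub>N-m+1-k\<^esub>\<close>, where the increasing
  enumerations of \<open>E\<close> and its complement start at index 1, whereas list positions start at 0.
\<close>

definition hook_tab :: "nat \<Rightarrow> nat \<Rightarrow> nat set \<Rightarrow> nat \<times> nat \<Rightarrow> nat" where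
  "hook_tab N m E = (\<lambda>(a, b).
     if b = 1 then sorted_list_of_set E ! (m + 1 - a)
     else sorted_list_of_set ({1..N} - E) ! (N - m - b))"

definition content :: "nat \<Rightarrow> nat \<Rightarrow> nat set \<Rightarrow> nat \<Rightarrow> int" where
  "content N m E i =
     (THE c. \<exists>a b. (a, b) \<in> hook_cells N m \<and> hook_tab N m E (a, b) = i \<and> c = int b - int a)"

definition is_tau :: "nat \<Rightarrow> nat \<Rightarrow> 'k::field \<Rightarrow> nat set \<Rightarrow> 'k ferm \<Rightarrow> bool" where
  "is_tau N m t E v \<longleftrightarrow>
     v \<in> P0_space N m t \<and>
     (\<forall>i\<in>{1..N}. omega N t i v = smul (t powi content N m E i) v) \<and>
     v - smul (t ^ inv_num N E) (psi N t E)
       \<in> ferm.span {psi N t F | F. F \<in> Y0 N m \<and> inv_num N F < inv_num N E}"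


section \<open>Compositions\<close>

definition compositions :: "nat \<Rightarrow> (nat \<Rightarrow>\<^sub>0 nat) set" where
  "compositions N = {\<alpha>. Poly_Mapping.keys \<alpha> \<subseteq> {1..N}}"

definition dec_compositions :: "nat \<Rightarrow> (nat \<Rightarrow>\<^sub>0 nat) set" where
  "dec_compositions N =
     {\<alpha> \<in> compositions N. \<forall>i j. 1 \<le> i \<and> i \<le> j \<and> j \<le> N
       \<longrightarrow> Poly_Mapping.lookup \<alpha> j \<le> Poly_Mapping.lookup \<alpha> i}"

definition dec_rearr :: "nat \<Rightarrow> (nat \<Rightarrow>\<^sub>0 nat) \<Rightarrow> nat \<Rightarrow> nat" where
  "dec_rearr N \<alpha> i = rev (sort (map (Poly_Mapping.lookup \<alpha>) [1..<Suc N])) ! (i - 1)"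

definition rank_fun :: "nat \<Rightarrow> (nat \<Rightarrow>\<^sub>0 nat) \<Rightarrow> nat \<Rightarrow> nat" where
  "rank_fun N \<alpha> i =
     (if i \<in> {1..N} then
        card {j\<in>{1..N}. Poly_Mapping.lookup \<alpha> j > Poly_Mapping.lookup \<alpha> i} +
        card {j\<in>{1..N}. j \<le> i \<and> Poly_Mapping.lookup \<alpha> j = Poly_Mapping.lookup \<alpha> i}
      else i)"

text \<open>\<open>compose_list [f\<^sub>1, \<dots>, f\<^sub>k]\<close> is the product \<open>f\<^sub>1 \<circ> \<dots> \<circ> f\<^sub>k\<close>.\<close>

definition compose_list :: "('a \<Rightarrow> 'a) list \<Rightarrow> 'a \<Rightarrow> 'a" where
  "compose_list fs = foldr (\<circ>) fs id"

definition word_of :: "nat \<Rightarrow> (nat \<Rightarrow> nat) \<Rightarrow> nat list \<Rightarrow> bool" where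
  "word_of N w is \<longleftrightarrow> set is \<subseteq> {1..<N} \<and> w = compose_list (map (\<lambda>i. transpose i (Suc i)) is)"

definition reduced_word :: "nat \<Rightarrow> (nat \<Rightarrow> nat) \<Rightarrow> nat list \<Rightarrow> bool" where
  "reduced_word N w is \<longleftrightarrow> word_of N w is \<and> (\<forall>js. word_of N w js \<longrightarrow> length is \<le> length js)"

text \<open>The choice of the reduced word is immaterial because of the braid relations.\<close>

definition R_op :: "nat \<Rightarrow> 'k::field \<Rightarrow> (nat \<Rightarrow>\<^sub>0 nat) \<Rightarrow> 'k ferm \<Rightarrow> 'k ferm" where
  "R_op N t \<alpha> = inv (compose_list (map (T_theta t) (SOME is. reduced_word N (rank_fun N \<alpha>) is)))"

definition tab_label :: "nat \<Rightarrow> nat \<Rightarrow> (nat \<Rightarrow>\<^sub>0 nat) \<Rightarrow> nat set \<Rightarrow> nat \<times> nat \<Rightarrow> nat" where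
  "tab_label N m \<alpha> E = restrict (\<lambda>c. dec_rearr N \<alpha> (hook_tab N m E c)) (hook_cells N m)"

definition row_strict :: "nat \<Rightarrow> nat \<Rightarrow> (nat \<times> nat \<Rightarrow> nat) \<Rightarrow> bool" where
  "row_strict N m Y \<longleftrightarrow> inj_on Y {c \<in> hook_cells N m. fst c = 1}"


section \<open>Superpolynomials\<close>

definition tensor :: "'k::comm_ring_1 pol \<Rightarrow> 'k ferm \<Rightarrow> 'k super" where
  "tensor p v = Poly_Mapping.map (\<lambda>c. Pconst c * p) v"

definition coeff_x :: "'k::comm_ring_1 super \<Rightarrow> (nat \<Rightarrow>\<^sub>0 nat) \<Rightarrow> 'k ferm" where
  "coeff_x f \<alpha> = Poly_Mapping.map (\<lambda>p. Poly_Mapping.lookup p \<alpha>) f"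

definition ssubst :: "(nat \<Rightarrow> 'k::comm_ring_1 pol) \<Rightarrow> 'k super \<Rightarrow> 'k super" where
  "ssubst \<sigma> f = Poly_Mapping.map (psubst \<sigma>) f"

definition ksmul :: "'k::comm_ring_1 \<Rightarrow> 'k super \<Rightarrow> 'k super" where
  "ksmul c f = smul (Pconst c) f"

global_interpretation super: vector_space "ksmul :: 'k::field \<Rightarrow> 'k super \<Rightarrow> 'k super"
proof unfold_locales
  show "ksmul (a + b) f = ksmul a f + ksmul b f" for a b :: 'k and f
    by (rule poly_mapping_eqI)
      (simp add: ksmul_def Pconst_def lookup_smul lookup_add single_add algebra_simps)
  show "ksmul a (ksmul b f) = ksmul (a * b) f" for a b :: 'k and f
  proof (rule poly_mapping_eqI)
    have eq: "Poly_Mapping.single (0 :: nat \<Rightarrow>\<^sub>0 nat) (a * b)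
        = Poly_Mapping.single 0 a * Poly_Mapping.single 0 b"
      by (simp add: mult_single)
    show "Poly_Mapping.lookup (ksmul a (ksmul b f)) k = Poly_Mapping.lookup (ksmul (a * b) f) k" for k
      by (simp only: ksmul_def Pconst_def lookup_smul eq mult.assoc)
  qed
qed (auto intro!: poly_mapping_eqI
       simp: ksmul_def Pconst_def lookup_smul lookup_add algebra_simps)

definition sP0_space :: "nat \<Rightarrow> nat \<Rightarrow> 'k::field \<Rightarrow> 'k super set" where
  "sP0_space N m t =
     super.span {tensor p v | p v. pol_in {1..N} p \<and> v \<in> P0_space N m t}"

definition bT :: "'k::field \<Rightarrow> nat \<Rightarrow> 'k super \<Rightarrow> 'k super" where
  "bT t i f =
     smul (Pconst (1 - t) * X (Suc i)) (Poly_Mapping.map (divdiff i) f)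
     + T_theta (Pconst t) i (Poly_Mapping.map (pswap i) f)"

definition w_op :: "nat \<Rightarrow> 'k::field \<Rightarrow> 'k \<Rightarrow> 'k super \<Rightarrow> 'k super" where
  "w_op N q t f =
     compose_list (map (T_theta (Pconst t)) (rev [1..<N]))
       (ssubst (\<lambda>j. if j = 1 then Pconst q * X N else X (j - 1)) f)"

definition xi :: "nat \<Rightarrow> 'k::field \<Rightarrow> 'k \<Rightarrow> nat \<Rightarrow> 'k super \<Rightarrow> 'k super" where
  "xi N q t i f =
     ksmul (t powi (int i - int N))
       ((compose_list (map (bT t) [i..<N]) \<circ> w_op N q t
         \<circ> compose_list (map (\<lambda>j. inv (bT t j)) [1..<i])) f)"


section \<open>Macdonald superpolynomials and the antisymmetric polynomial\<close>

definition is_macdonald ::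
  "nat \<Rightarrow> nat \<Rightarrow> 'k::field \<Rightarrow> 'k \<Rightarrow> (nat set \<Rightarrow> 'k ferm) \<Rightarrow> (nat \<Rightarrow>\<^sub>0 nat) \<Rightarrow> nat set \<Rightarrow> 'k super \<Rightarrow> bool"
  where
  "is_macdonald N m q t \<tau> \<alpha> E f \<longleftrightarrow>
     f \<in> sP0_space N m t \<and>
     (\<forall>i\<in>{1..N}.
        xi N q t i f = ksmul (q ^ Poly_Mapping.lookup \<alpha> i * t powi content N m E (rank_fun N \<alpha> i)) f) \<and>
     coeff_x f \<alpha> =
       smul (t powi (\<Sum>i=1..N. int (dec_rearr N \<alpha> i) * (int N - int i + content N m E i))
             * q ^ (\<Sum>i=1..N. Poly_Mapping.lookup \<alpha> i choose 2))
         (R_op N t \<alpha> (\<tau> E))"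

definition M_basis ::
  "nat \<Rightarrow> nat \<Rightarrow> ((nat \<Rightarrow>\<^sub>0 nat) \<Rightarrow> nat set \<Rightarrow> 'k::field super) \<Rightarrow> (nat \<Rightarrow>\<^sub>0 nat) \<Rightarrow> nat set \<Rightarrow> 'k super set"
  where
  "M_basis N m M lam E =
     {M \<beta> F | \<beta> F. \<beta> \<in> compositions N \<and> F \<in> Y0 N m \<and> tab_label N m \<beta> F = tab_label N m lam E}"

definition E_S :: "nat \<Rightarrow> nat \<Rightarrow> (nat \<Rightarrow>\<^sub>0 nat) \<Rightarrow> nat set \<Rightarrow> nat set" where
  "E_S N m lam E = arg_max (inv_num N) (\<lambda>F. F \<in> Y0 N m \<and> tab_label N m lam F = tab_label N m lam E)"

text \<open>
  The Macdonald polynomials \<open>M \<beta> F\<close> are simultaneous eigenvectors with pairwise distinct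
  spectral vectors, so \<open>M_basis\<close> is independent and the coefficient is well-defined.
\<close>

definition is_antisym_macdonald ::
  "nat \<Rightarrow> nat \<Rightarrow> 'k::field \<Rightarrow> ((nat \<Rightarrow>\<^sub>0 nat) \<Rightarrow> nat set \<Rightarrow> 'k super) \<Rightarrow> (nat \<Rightarrow>\<^sub>0 nat) \<Rightarrow> nat set \<Rightarrow> 'k super \<Rightarrow> bool"
  where
  "is_antisym_macdonald N m t M lam E f \<longleftrightarrow>
     f \<in> super.span (M_basis N m M lam E) \<and>
     (\<forall>i. 1 \<le> i \<and> i < N \<longrightarrow> bT t i f = - f) \<and>
     super.representation (M_basis N m M lam E) f (M lam (E_S N m lam E)) = 1"

definition special_point :: "nat \<Rightarrow> nat \<Rightarrow> 'k::field \<Rightarrow> nat \<Rightarrow> 'k pol" where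
  "special_point N m t i = (if i \<le> N - m - 1 then X i else Pconst (inverse t ^ (N - i)))"

end

theory Submission
  imports Defs
begin

text \<open>
  The antisymmetric polynomial enters only through two of its properties: it lies in
  \<open>s\<P>\<^bsub>m,0\<^esub>\<close>, and every \<open>\<^bold>T\<^sub>i\<close> acts on it as \<open>-1\<close>. Write \<open>n = N - m - 1\<close>, so that the
  special point has \<open>n\<close> free coordinates.

  After multiplication by \<open>x\<^sub>i - x\<^bsub>i+1\<^esub>\<close> the equation \<open>\<^bold>T\<^sub>i p = -p\<close> reads
  \<open>(x\<^sub>i - t x\<^bsub>i+1\<^esub>) p(x) = ((1-t) x\<^bsub>i+1\<^esub> - (x\<^sub>i - x\<^bsub>i+1\<^esub>) T\<^sub>i) p(x s\<^sub>i)\<close>.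
  If \<open>x s\<^sub>i\<close> is a point \<open>z\<close> with \<open>z\<^bsub>i+1\<^esub> = t z\<^sub>i \<noteq> 0\<close>, the left side vanishes and
  \<open>T\<^sub>i p(z) = -p(z)\<close> remains (\<open>antisym_at_value\<close>). At the special point this happens whenever
  \<open>i\<close> and \<open>i + 1\<close> lie in the block \<open>{N - m..N}\<close> of \<open>m + 1\<close> indices. A form of degree \<open>m\<close> that is
  antisymmetric on this block is a multiple of \<open>D \<phi>\<close> for the block
  (\<open>antisym_block_unique\<close>), which is \<open>\<tau>\<close> for \<open>E\<^sub>0\<close>. Hence
  \<open>p(z) = g(z\<^sub>1, \<dots>, z\<^sub>n) \<tau>\<close> with a polynomial \<open>g\<close>.

  For \<open>i < n\<close> the operator \<open>T\<^sub>i\<close> acts on \<open>\<tau>\<close> as \<open>t\<close>, and the same equation says that the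
  quotient of \<open>g\<close> by \<open>\<Prod>\<^bsub>i<j\<^esub> (t z\<^sub>i - z\<^sub>j)\<close> is invariant under the adjacent transpositions, hence
  symmetric (\<open>quotient_by_tVandermonde_symmetric\<close>). The factor \<open>t z\<^sub>i - z\<^sub>j\<close> is prime and
  does not divide the image of the product under the transposition \<open>(i j)\<close>, so the
  symmetry forces it to divide \<open>g\<close>. Finally, if \<open>z\<^sub>n = t\<^bsup>-m-1\<^esup>\<close>, then the block has one index more and
  leaves no antisymmetric form of degree \<open>m\<close>. So \<open>t\<^bsup>m+1\<^esup> z\<^sub>n - 1\<close> divides \<open>g\<close>, and by symmetry
  the same is true for the other variables (\<open>tVandermonde_mult_linear_dvd\<close>). The cofactor
  is \<open>p\<^sub>0\<close>.
\<close>

section \<open>Substitution homomorphisms\<close>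

lemma psubst_altdef:
  assumes "finite A" "Poly_Mapping.keys p \<subseteq> A"
  shows "psubst \<sigma> p = (\<Sum>\<mu>\<in>A. Pconst (Poly_Mapping.lookup p \<mu>) *
           (\<Prod>j\<in>Poly_Mapping.keys \<mu>. \<sigma> j ^ Poly_Mapping.lookup \<mu> j))"
  unfolding psubst_def
  by (rule sum.mono_neutral_left) (use assms in \<open>auto simp: in_keys_iff Pconst_def\<close>)

lemma Pconst_0 [simp]: "Pconst 0 = 0"
  and Pconst_1 [simp]: "Pconst 1 = 1"
  and Pconst_add: "Pconst (a + b) = Pconst a + Pconst b"
  and Pconst_diff: "Pconst (a - b) = Pconst a - Pconst b"
  and Pconst_uminus: "Pconst (- a) = - Pconst a"
  and Pconst_mult: "Pconst (a * b) = Pconst a * Pconst b"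
  by (simp_all add: Pconst_def single_add single_diff single_uminus mult_single)

lemma Pconst_power: "Pconst (a ^ n) = Pconst a ^ n"
  by (induction n) (simp_all add: Pconst_mult)

lemma Pconst_eq_0_iff [simp]: "Pconst a = 0 \<longleftrightarrow> a = 0"
  by (metis Pconst_0 Pconst_def lookup_single_eq)

lemma psubst_0 [simp]: "psubst \<sigma> 0 = 0"
  by (simp add: psubst_def)

lemma psubst_add: "psubst \<sigma> (p + r) = psubst \<sigma> p + psubst \<sigma> r"
proof -
  let ?A = "Poly_Mapping.keys p \<union> Poly_Mapping.keys r"
  show ?thesis
    by (subst (1 2 3) psubst_altdef[of ?A])
      (auto simp: lookup_add Pconst_add algebra_simps sum.distrib dest!: subsetD[OF keys_add])
qed

lemma psubst_sum: "psubst \<sigma> (\<Sum>a\<in>A. f a) = (\<Sum>a\<in>A. psubst \<sigma> (f a))"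
  by (induction A rule: infinite_finite_induct) (simp_all add: psubst_add)

lemma psubst_single:
  "psubst \<sigma> (Poly_Mapping.single \<mu> c) =
     Pconst c * (\<Prod>j\<in>Poly_Mapping.keys \<mu>. \<sigma> j ^ Poly_Mapping.lookup \<mu> j)"
  by (subst psubst_altdef[of "{\<mu>}"]) auto

lemma monomial_value_add:
  fixes \<sigma> :: "nat \<Rightarrow> 'k::comm_ring_1 pol"
  shows "(\<Prod>j\<in>Poly_Mapping.keys (\<mu> + \<nu>). \<sigma> j ^ Poly_Mapping.lookup (\<mu> + \<nu>) j) =
     (\<Prod>j\<in>Poly_Mapping.keys \<mu>. \<sigma> j ^ Poly_Mapping.lookup \<mu> j) *
     (\<Prod>j\<in>Poly_Mapping.keys \<nu>. \<sigma> j ^ Poly_Mapping.lookup \<nu> j)"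
proof -
  let ?A = "Poly_Mapping.keys \<mu> \<union> Poly_Mapping.keys \<nu>"
  have *: "(\<Prod>j\<in>Poly_Mapping.keys \<rho>. \<sigma> j ^ Poly_Mapping.lookup \<rho> j) =
             (\<Prod>j\<in>?A. \<sigma> j ^ Poly_Mapping.lookup \<rho> j)"
    if "Poly_Mapping.keys \<rho> \<subseteq> ?A" for \<rho>
    by (rule prod.mono_neutral_left) (use that in \<open>auto simp: in_keys_iff\<close>)
  show ?thesis
    by (subst (1 2 3) *)
      (auto simp: lookup_add power_add prod.distrib dest!: subsetD[OF keys_add])
qed

lemma psubst_single_mult:
  "psubst \<sigma> (Poly_Mapping.single \<mu> c * Poly_Mapping.single \<nu> d) =
     psubst \<sigma> (Poly_Mapping.single \<mu> c) * psubst \<sigma> (Poly_Mapping.single \<nu> d)"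
  by (simp add: mult_single psubst_single monomial_value_add Pconst_mult mult_ac)

lemma pol_as_sum:
  fixes p :: "'k::comm_ring_1 pol"
  shows "p = (\<Sum>\<mu>\<in>Poly_Mapping.keys p. Poly_Mapping.single \<mu> (Poly_Mapping.lookup p \<mu>))"
proof (rule poly_mapping_eqI)
  fix \<nu>
  show "Poly_Mapping.lookup p \<nu> =
      Poly_Mapping.lookup (\<Sum>\<mu>\<in>Poly_Mapping.keys p. Poly_Mapping.single \<mu> (Poly_Mapping.lookup p \<mu>)) \<nu>"
    by (simp add: lookup_sum lookup_single when_def in_keys_iff)
qed

lemma psubst_mult: "psubst \<sigma> (p * r) = psubst \<sigma> p * psubst \<sigma> r"
proof -
  have "psubst \<sigma> ((\<Sum>\<mu>\<in>A. Poly_Mapping.single \<mu> (f \<mu>)) * (\<Sum>\<nu>\<in>B. Poly_Mapping.single \<nu> (g \<nu>))) =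
      psubst \<sigma> (\<Sum>\<mu>\<in>A. Poly_Mapping.single \<mu> (f \<mu>)) *
      psubst \<sigma> (\<Sum>\<nu>\<in>B. Poly_Mapping.single \<nu> (g \<nu>))" for A B f g
    by (simp only: sum_product psubst_sum psubst_single_mult)
  from this[of "Poly_Mapping.lookup p" "Poly_Mapping.keys p"
      "Poly_Mapping.lookup r" "Poly_Mapping.keys r"]
  show ?thesis
    by (simp only: pol_as_sum[symmetric])
qed

lemma psubst_Pconst [simp]: "psubst \<sigma> (Pconst c) = Pconst c"
  unfolding Pconst_def by (simp add: psubst_single) (simp add: Pconst_def)

lemma psubst_X [simp]: "psubst \<sigma> (X i) = \<sigma> i"
  by (simp add: X_def psubst_single)

lemma psubst_1 [simp]: "psubst \<sigma> 1 = 1"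
  using psubst_Pconst[of \<sigma> 1] by simp

lemma psubst_uminus: "psubst \<sigma> (- p) = - psubst \<sigma> p"
  using psubst_add[of \<sigma> p "- p"] by (simp add: eq_neg_iff_add_eq_0 add.commute)

lemma psubst_diff: "psubst \<sigma> (p - r) = psubst \<sigma> p - psubst \<sigma> r"
  using psubst_add[of \<sigma> p "- r"] by (simp add: psubst_uminus)

lemma psubst_power: "psubst \<sigma> (p ^ n) = psubst \<sigma> p ^ n"
  by (induction n) (simp_all add: psubst_mult)

lemma psubst_prod: "psubst \<sigma> (\<Prod>a\<in>A. f a) = (\<Prod>a\<in>A. psubst \<sigma> (f a))"
  by (induction A rule: infinite_finite_induct) (simp_all add: psubst_mult)

lemmas psubst_hom = psubst_add psubst_diff psubst_uminus psubst_mult psubst_power psubst_prod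

lemma psubst_psubst: "psubst \<sigma> (psubst \<rho> p) = psubst (\<lambda>j. psubst \<sigma> (\<rho> j)) p"
  by (subst (2) psubst_def, subst (2) psubst_def) (simp add: psubst_sum psubst_hom)

lemma single_as_product:
  fixes c :: "'k::comm_ring_1"
  shows "Poly_Mapping.single \<mu> c =
     Pconst c * (\<Prod>j\<in>Poly_Mapping.keys \<mu>. X j ^ Poly_Mapping.lookup \<mu> j)"
proof -
  have pow: "X j ^ n = Poly_Mapping.single (Poly_Mapping.single j n) (1 :: 'k)" for j n
    by (induction n) (simp_all add: X_def mult_single single_add[symmetric])
  have prod: "(\<Prod>j\<in>A. Poly_Mapping.single (f j) (1 :: 'k)) = Poly_Mapping.single (\<Sum>j\<in>A. f j) 1"
    if "finite A" for A :: "nat set" and f :: "nat \<Rightarrow> nat \<Rightarrow>\<^sub>0 nat"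
    using that by induction (simp_all add: mult_single)
  have "(\<Sum>j\<in>Poly_Mapping.keys \<mu>. Poly_Mapping.single j (Poly_Mapping.lookup \<mu> j)) = \<mu>"
    by (rule poly_mapping_eqI) (simp add: lookup_sum lookup_single when_def in_keys_iff)
  then show ?thesis
    by (simp add: pow prod Pconst_def mult_single)
qed

lemma psubst_cong_on:
  assumes "pol_in V p" "\<And>j. j \<in> V \<Longrightarrow> \<sigma> j = \<rho> j"
  shows "psubst \<sigma> p = psubst \<rho> p"
  unfolding psubst_def using assms
  by (intro sum.cong arg_cong2[where f = "(*)"] prod.cong refl) (metis pol_in_def subsetD)

lemma psubst_ident: "psubst X p = p"
  by (subst (2) pol_as_sum, subst psubst_def) (simp add: single_as_product[symmetric])

lemma psubst_id_on:
  assumes "pol_in V p" "\<And>j. j \<in> V \<Longrightarrow> \<sigma> j = X j"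
  shows "psubst \<sigma> p = p"
  using psubst_cong_on[of V p \<sigma> X] assms by (simp add: psubst_ident)

lemma pol_in_0 [simp]: "pol_in V 0"
  by (simp add: pol_in_def)

lemma pol_in_Pconst [simp]: "pol_in V (Pconst c)"
  by (simp add: pol_in_def Pconst_def)

lemma pol_in_1 [simp]: "pol_in V 1"
  using pol_in_Pconst[of V 1] by simp

lemma pol_in_X: "i \<in> V \<Longrightarrow> pol_in V (X i)"
  by (simp add: pol_in_def X_def)

lemma pol_in_add: "pol_in V p \<Longrightarrow> pol_in V r \<Longrightarrow> pol_in V (p + r)"
  unfolding pol_in_def by (meson UnE keys_add subsetD)

lemma pol_in_uminus: "pol_in V p \<Longrightarrow> pol_in V (- p)"
  unfolding pol_in_def by simp

lemma pol_in_diff: "pol_in V p \<Longrightarrow> pol_in V r \<Longrightarrow> pol_in V (p - r)"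
  using pol_in_add[of V p "- r"] pol_in_uminus[of V r] by simp

lemma pol_in_mult:
  assumes "pol_in V p" "pol_in V r"
  shows "pol_in V (p * r)"
  unfolding pol_in_def
proof
  fix \<mu> assume "\<mu> \<in> Poly_Mapping.keys (p * r)"
  then obtain a b where "\<mu> = a + b" "a \<in> Poly_Mapping.keys p" "b \<in> Poly_Mapping.keys r"
    using keys_mult by fastforce
  with assms show "Poly_Mapping.keys \<mu> \<subseteq> V"
    unfolding pol_in_def using keys_add[of a b] by blast
qed

lemma pol_in_prod: "(\<And>a. a \<in> A \<Longrightarrow> pol_in V (f a)) \<Longrightarrow> pol_in V (\<Prod>a\<in>A. f a)"
  by (induction A rule: infinite_finite_induct) (auto intro: pol_in_mult)

lemma pol_in_power: "pol_in V p \<Longrightarrow> pol_in V (p ^ n)"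
  by (induction n) (auto intro: pol_in_mult)

lemma pol_in_sum: "(\<And>a. a \<in> A \<Longrightarrow> pol_in V (f a)) \<Longrightarrow> pol_in V (\<Sum>a\<in>A. f a)"
  by (induction A rule: infinite_finite_induct) (auto intro: pol_in_add)

lemma pol_in_psubst:
  assumes "pol_in W p" "\<And>j. j \<in> W \<Longrightarrow> pol_in V (\<sigma> j)"
  shows "pol_in V (psubst \<sigma> p)"
  unfolding psubst_def using assms
  by (intro pol_in_sum pol_in_mult pol_in_prod pol_in_power pol_in_Pconst)
    (metis pol_in_def subsetD)

section \<open>Linear prime factors\<close>

text \<open>
  Two substitutions that agree modulo \<open>d\<close> on the variables agree modulo \<open>d\<close> on every
  monomial. This gives both the polynomial divided differences and the factor theorem.
\<close>

lemma dvd_diff_psubst: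
  fixes p :: "'k::comm_ring_1 pol"
  assumes "\<And>j. d dvd \<sigma> j - \<rho> j"
  shows "d dvd psubst \<sigma> p - psubst \<rho> p"
proof -
  have mult: "d dvd a * b - a' * b'" if "d dvd a - a'" "d dvd b - b'" for a b a' b' :: "'k pol"
  proof -
    have "a * b - a' * b' = (a - a') * b + a' * (b - b')"
      by (simp add: algebra_simps)
    with that show ?thesis by simp
  qed
  have pow: "d dvd \<sigma> j ^ n - \<rho> j ^ n" for j n
    by (induction n) (auto intro: mult assms)
  have prod: "d dvd (\<Prod>j\<in>A. \<sigma> j ^ f j) - (\<Prod>j\<in>A. \<rho> j ^ f j)" if "finite A" for A f
    using that by induction (auto intro: mult pow)
  have "psubst \<sigma> p - psubst \<rho> p = (\<Sum>\<mu>\<in>Poly_Mapping.keys p. Pconst (Poly_Mapping.lookup p \<mu>) *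
     ((\<Prod>j\<in>Poly_Mapping.keys \<mu>. \<sigma> j ^ Poly_Mapping.lookup \<mu> j) -
      (\<Prod>j\<in>Poly_Mapping.keys \<mu>. \<rho> j ^ Poly_Mapping.lookup \<mu> j)))"
    by (simp add: psubst_def sum_subtractf[symmetric] right_diff_distrib)
  also have "d dvd \<dots>"
    by (intro dvd_sum dvd_mult prod) auto
  finally show ?thesis .
qed

text \<open>
  The quotient of the polynomial ring by \<open>X v - a\<close>, where \<open>a\<close> does not involve \<open>X v\<close>, is the image
  of the substitution \<open>X v \<mapsto> a\<close>.
\<close>

lemma linear_dvd_iff:
  fixes f :: "'k::comm_ring_1 pol"
  assumes u: "u dvd 1" and a: "psubst (X(v := a)) a = a"
  shows "u * (X v - a) dvd f \<longleftrightarrow> psubst (X(v := a)) f = 0"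
proof
  assume "u * (X v - a) dvd f"
  then show "psubst (X(v := a)) f = 0"
    using a by (auto simp: dvd_def psubst_hom)
next
  assume 0: "psubst (X(v := a)) f = 0"
  have "X v - a dvd psubst X f - psubst (X(v := a)) f"
    by (rule dvd_diff_psubst) auto
  then have "X v - a dvd f"
    by (simp add: 0 psubst_ident)
  with u show "u * (X v - a) dvd f"
    using mult_dvd_mono[of u 1 "X v - a" f] by simp
qed

lemma linear_prime:
  fixes a :: "'k::field pol"
  assumes u: "u dvd 1" and a: "psubst (X(v := a)) a = a" and nz: "X v \<noteq> a"
  shows "prime_elem (u * (X v - a))"
proof (rule prime_elemI)
  show "u * (X v - a) \<noteq> 0"
    using u nz by auto
  show "\<not> u * (X v - a) dvd 1"
    using linear_dvd_iff[OF u a, of 1] by simp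
  show "u * (X v - a) dvd p \<or> u * (X v - a) dvd r" if "u * (X v - a) dvd p * r" for p r
    using that by (simp add: linear_dvd_iff[OF u a] psubst_mult)
qed

lemma prime_elem_dvd_prodD:
  assumes "prime_elem p" "p dvd (\<Prod>a\<in>A. f a)"
  shows "\<exists>a\<in>A. p dvd f a"
  using assms
  by (induction A rule: infinite_finite_induct)
    (auto simp: prime_elem_dvd_mult_iff prime_elem_not_unit)

lemma mult_prod_dvdI:
  fixes l :: "'a \<Rightarrow> 'b::idom"
  assumes "finite A" "d dvd g"
    and "\<And>a. a \<in> A \<Longrightarrow> prime_elem (l a)" "\<And>a. a \<in> A \<Longrightarrow> l a dvd g"
    and "\<And>a. a \<in> A \<Longrightarrow> \<not> l a dvd d"
    and "\<And>a b. a \<in> A \<Longrightarrow> b \<in> A \<Longrightarrow> a \<noteq> b \<Longrightarrow> \<not> l a dvd l b"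
  shows "d * (\<Prod>a\<in>A. l a) dvd g"
  using assms
proof (induction A rule: finite_induct)
  case empty
  then show ?case by simp
next
  case (insert a A)
  from insert.IH insert.prems obtain h where h: "g = d * (\<Prod>b\<in>A. l b) * h"
    by (auto simp: dvd_def)
  have prime: "prime_elem (l a)"
    using insert.prems by simp
  have "\<not> l a dvd (\<Prod>b\<in>A. l b)"
  proof
    assume "l a dvd (\<Prod>b\<in>A. l b)"
    then obtain b where "b \<in> A" "l a dvd l b"
      using prime_elem_dvd_prodD[OF prime] by blast
    then show False
      using insert.prems(5)[of a b] insert.hyps by auto
  qed
  moreover have "l a dvd d * (\<Prod>b\<in>A. l b) * h"
    using insert.prems(3) h by simp
  ultimately have "l a dvd h"
    using insert.prems(4) by (simp add: prime_elem_dvd_mult_iff[OF prime])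
  then show ?case
    using insert.hyps h by (auto simp: dvd_def mult_ac)
qed

lemma X_neq_Pconst_mult_X:
  assumes "i \<noteq> j"
  shows "X i \<noteq> (Pconst c * X j :: 'k::field pol)"
proof
  assume "X i = (Pconst c * X j :: 'k pol)"
  from arg_cong[OF this, of "psubst (\<lambda>k. if k = i then 1 else 0)"] assms show False
    by (simp add: psubst_mult)
qed

section \<open>The operators in coordinates\<close>

lemma lookup_phi: "Poly_Mapping.lookup (phi F) E = (if E = F then 1 else 0)"
  by (simp add: phi_def lookup_single when_def)

lemma lookup_lin_ext:
  assumes "finite A" "\<And>a. a \<notin> A \<Longrightarrow> Poly_Mapping.lookup (f a) b = 0"
  shows "Poly_Mapping.lookup (lin_ext f v) b =
    (\<Sum>a\<in>A. Poly_Mapping.lookup v a * Poly_Mapping.lookup (f a) b)"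
proof -
  have "Poly_Mapping.lookup (lin_ext f v) b =
      (\<Sum>a\<in>Poly_Mapping.keys v. Poly_Mapping.lookup v a * Poly_Mapping.lookup (f a) b)"
    by (simp add: lin_ext_def lookup_sum lookup_smul)
  also have "\<dots> = (\<Sum>a\<in>Poly_Mapping.keys v \<union> A. Poly_Mapping.lookup v a * Poly_Mapping.lookup (f a) b)"
    by (rule sum.mono_neutral_left) (use assms in \<open>auto simp: in_keys_iff\<close>)
  also have "\<dots> = (\<Sum>a\<in>A. Poly_Mapping.lookup v a * Poly_Mapping.lookup (f a) b)"
    by (rule sum.mono_neutral_right) (use assms in auto)
  finally show ?thesis .
qed

lemma lin_ext_phi: "lin_ext f (phi E) = (f E :: 'b \<Rightarrow>\<^sub>0 'r::comm_ring_1)"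
  by (rule poly_mapping_eqI) (simp add: lin_ext_def phi_def lookup_smul)

lemma transpose_image_eq_iff:
  "transpose i j ` A = B \<longleftrightarrow> A = transpose i j ` B"
  by (auto simp: image_image)

lemma lookup_T_theta:
  fixes f :: "'r::comm_ring_1 ferm"
  defines "s \<equiv> \<lambda>i. transpose i (Suc i)"
  shows "i \<notin> E \<Longrightarrow> Suc i \<notin> E \<Longrightarrow>
      Poly_Mapping.lookup (T_theta t i f) E = t * Poly_Mapping.lookup f E"
    and "i \<in> E \<Longrightarrow> Suc i \<notin> E \<Longrightarrow>
      Poly_Mapping.lookup (T_theta t i f) E = t * Poly_Mapping.lookup f (s i ` E)"
proof -
  let ?T = "\<lambda>F. if i \<in> F \<and> Suc i \<in> F then - phi F
     else if i \<notin> F \<and> Suc i \<notin> F then smul t (phi F)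
     else if i \<in> F then phi (s i ` F)
     else smul (t - 1) (phi F) + smul t (phi (s i ` F)) :: 'r ferm"
  have T: "Poly_Mapping.lookup (T_theta t i f) E =
      (\<Sum>F\<in>{E, s i ` E}. Poly_Mapping.lookup f F * Poly_Mapping.lookup (?T F) E)"
    unfolding T_theta_def s_def
    by (rule lookup_lin_ext)
      (auto simp: lookup_phi lookup_smul lookup_add image_image)
  have swap: "i \<in> s i ` E \<longleftrightarrow> Suc i \<in> E" "Suc i \<in> s i ` E \<longleftrightarrow> i \<in> E"
    by (auto simp: s_def image_iff transpose_def split: if_splits)
  have inv: "s i ` s i ` E = E"
    by (simp add: s_def image_image)
  show "Poly_Mapping.lookup (T_theta t i f) E = t * Poly_Mapping.lookup f E"
    if "i \<notin> E" "Suc i \<notin> E"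
  proof -
    have "s i j = j" if "j \<in> E" for j
      using that \<open>i \<notin> E\<close> \<open>Suc i \<notin> E\<close> by (auto simp: s_def transpose_def)
    then have "s i ` E = E" by force
    with that show ?thesis
      unfolding T by (simp add: lookup_smul lookup_phi)
  qed
  show "Poly_Mapping.lookup (T_theta t i f) E = t * Poly_Mapping.lookup f (s i ` E)"
    if "i \<in> E" "Suc i \<notin> E"
  proof -
    have "E \<noteq> s i ` E"
      using that swap by blast
    with that show ?thesis
      unfolding T by (simp add: swap inv lookup_smul lookup_add lookup_phi)
  qed
qed

lemma lookup_psi_interval:
  fixes t :: "'r::comm_ring_1"
  assumes "1 \<le> a"
  shows "a \<le> k \<Longrightarrow> k \<le> N \<Longrightarrow>
      Poly_Mapping.lookup (psi N t {a..N}) ({a..N} - {k}) = t ^ (k - 1) * (- 1) ^ (k - a)"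
    and "(\<And>k. k \<in> {a..N} \<Longrightarrow> E \<noteq> {a..N} - {k}) \<Longrightarrow>
      Poly_Mapping.lookup (psi N t {a..N}) E = 0"
proof -
  have partial: "Poly_Mapping.lookup (partial i (phi {a..N})) E =
      (if i \<in> {a..N} \<and> E = {a..N} - {i} then (- 1) ^ (i - a) else (0 :: 'r))" for i E
  proof -
    have "{j \<in> {a..N}. j < i} = {a..<i}" if "i \<in> {a..N}"
      using that by auto
    then show ?thesis
      by (auto simp: partial_def lin_ext_phi lookup_smul lookup_phi)
  qed
  have psi: "Poly_Mapping.lookup (psi N t {a..N}) E =
      (\<Sum>i=1..N. t ^ (i - 1) * (if i \<in> {a..N} \<and> E = {a..N} - {i} then (- 1) ^ (i - a) else 0))" for E
    by (simp add: psi_def D_op_def lookup_sum lookup_smul partial)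
  show "Poly_Mapping.lookup (psi N t {a..N}) ({a..N} - {k}) = t ^ (k - 1) * (- 1) ^ (k - a)"
    if k: "a \<le> k" "k \<le> N"
  proof -
    have iff: "i \<in> {a..N} \<and> {a..N} - {k} = {a..N} - {i} \<longleftrightarrow> i = k" for i
    proof
      assume i: "i \<in> {a..N} \<and> {a..N} - {k} = {a..N} - {i}"
      then have "i \<notin> {a..N} - {k}" by blast
      with i show "i = k" by blast
    qed (use k in simp)
    have "Poly_Mapping.lookup (psi N t {a..N}) ({a..N} - {k}) =
        (\<Sum>i=1..N. if i = k then t ^ (k - 1) * (- 1) ^ (k - a) else 0)"
      unfolding psi iff by (rule sum.cong) auto
    then show ?thesis
      using k assms by simp
  qed
  show "Poly_Mapping.lookup (psi N t {a..N}) E = 0" if "\<And>k. k \<in> {a..N} \<Longrightarrow> E \<noteq> {a..N} - {k}"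
    unfolding psi
  proof (rule sum.neutral, intro ballI)
    fix i
    have "\<not> (i \<in> {a..N} \<and> E = {a..N} - {i})"
      using that[of i] by blast
    then show "t ^ (i - 1) * (if i \<in> {a..N} \<and> E = {a..N} - {i} then (- 1) ^ (i - a) else 0) = 0"
      by (simp only: if_False mult_zero_right)
  qed
qed

lemma pswap_0 [simp]: "pswap i 0 = 0"
  by (simp add: pswap_def)

lemma X_diff_Suc_neq_0: "X i - X (Suc i) \<noteq> (0 :: 'k::field pol)"
  using X_neq_Pconst_mult_X[of i "Suc i" 1] by simp

lemma divdiff_eq:
  fixes p :: "'k::field pol"
  shows "(X i - X (Suc i)) * divdiff i p = p - pswap i p"
proof -
  have dvd: "X i - X (Suc i) dvd X j - (X (transpose i (Suc i) j) :: 'k pol)" for j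
  proof -
    have "X i - X (Suc i) dvd (X (Suc i) - X i :: 'k pol)"
      using dvd_minus_iff[of "X i - X (Suc i) :: 'k pol" "X i - X (Suc i)"] by simp
    then show ?thesis
      by (auto simp: transpose_def)
  qed
  have "X i - X (Suc i) dvd psubst X p - pswap i p"
    unfolding pswap_def by (rule dvd_diff_psubst) (rule dvd)
  then obtain r where r: "p - pswap i p = (X i - X (Suc i)) * r"
    by (auto simp: dvd_def psubst_ident)
  have "divdiff i p = r"
    unfolding divdiff_def
  proof (rule the_equality)
    show "r' = r" if "(X i - X (Suc i)) * r' = p - pswap i p" for r'
      using that r mult_left_cancel[OF X_diff_Suc_neq_0] by metis
  qed (rule r[symmetric])
  with r show ?thesis by simp
qed

lemma divdiff_0 [simp]: "divdiff i (0 :: 'k::field pol) = 0"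
  using divdiff_eq[of i "0 :: 'k pol"] X_diff_Suc_neq_0[of i, where 'k = 'k] by simp

lemma lookup_map: "f 0 = 0 \<Longrightarrow> Poly_Mapping.lookup (Poly_Mapping.map f p) a = f (Poly_Mapping.lookup p a)"
  by (simp add: map.rep_eq when_def)

text \<open>Clearing the denominator \<open>X i - X (Suc i)\<close> in the equation \<open>bT t i f = - f\<close>.\<close>

lemma bT_antisymmetric_cleared:
  fixes f :: "'k::field super"
  assumes "bT t i f = - f"
  shows "(X i - Pconst t * X (Suc i)) * Poly_Mapping.lookup f E =
     Pconst (1 - t) * X (Suc i) * pswap i (Poly_Mapping.lookup f E)
     - (X i - X (Suc i)) *
       Poly_Mapping.lookup (T_theta (Pconst t) i (Poly_Mapping.map (pswap i) f)) E"
proof -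
  let ?d = "divdiff i (Poly_Mapping.lookup f E)"
  let ?T = "Poly_Mapping.lookup (T_theta (Pconst t) i (Poly_Mapping.map (pswap i) f)) E"
  have "Pconst (1 - t) * X (Suc i) * ?d + ?T = - Poly_Mapping.lookup f E"
    using arg_cong[OF assms, of "\<lambda>g. Poly_Mapping.lookup g E"]
    by (simp add: bT_def lookup_add lookup_smul lookup_map)
  then have "(X i - X (Suc i)) * (- Poly_Mapping.lookup f E) =
      (X i - X (Suc i)) * (Pconst (1 - t) * X (Suc i) * ?d + ?T)"
    by simp
  also have "\<dots> = Pconst (1 - t) * X (Suc i) * ((X i - X (Suc i)) * ?d) + (X i - X (Suc i)) * ?T"
    by (simp add: algebra_simps)
  finally show ?thesis
    unfolding divdiff_eq by (simp add: Pconst_diff algebra_simps)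
qed

lemma bT_antisymmetric_coeff:
  fixes f :: "'k::field super"
  assumes "bT t i f = - f"
  shows "i \<notin> E \<Longrightarrow> Suc i \<notin> E \<Longrightarrow>
     (X i - Pconst t * X (Suc i)) * Poly_Mapping.lookup f E =
     (X (Suc i) - Pconst t * X i) * pswap i (Poly_Mapping.lookup f E)"
   and "i \<in> E \<Longrightarrow> Suc i \<notin> E \<Longrightarrow>
     (X i - Pconst t * X (Suc i)) * Poly_Mapping.lookup f E =
     Pconst (1 - t) * X (Suc i) * pswap i (Poly_Mapping.lookup f E)
     - Pconst t * (X i - X (Suc i)) * pswap i (Poly_Mapping.lookup f (transpose i (Suc i) ` E))"
  unfolding bT_antisymmetric_cleared[OF assms]
  by (simp_all add: lookup_T_theta lookup_map Pconst_diff algebra_simps)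

section \<open>Antisymmetry on a block of consecutive indices\<close>

text \<open>
  The coefficient function \<open>c\<close> of a fermionic polynomial \<open>v\<close> satisfies this condition exactly when
  \<open>T\<^sub>i v = - v\<close>, provided that \<open>1 + t\<close> is not a zero divisor.
\<close>

definition antisym_at :: "'r::comm_ring_1 \<Rightarrow> nat \<Rightarrow> (nat set \<Rightarrow> 'r) \<Rightarrow> bool" where
  "antisym_at t i c \<longleftrightarrow>
     (\<forall>E. i \<notin> E \<longrightarrow> Suc i \<notin> E \<longrightarrow> c E = 0) \<and>
     (\<forall>E. i \<in> E \<longrightarrow> Suc i \<notin> E \<longrightarrow> c E = - t * c (transpose i (Suc i) ` E))"

text \<open>
  Substituting \<open>X i \<mapsto> \<sigma> (Suc i)\<close> and \<open>X (Suc i) \<mapsto> \<sigma> i\<close> annihilates the factor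
  \<open>X i - t X (Suc i)\<close>; the swapped coefficients then become values at \<open>\<sigma>\<close>. So \<open>\<^bold>T\<^sub>i\<close> degenerates
  to the action of \<open>T\<^sub>i\<close> on the value at such a point.
\<close>

lemma antisym_at_value:
  fixes f :: "'k::field super"
  assumes f: "bT t i f = - f"
    and \<sigma>: "\<sigma> (Suc i) = Pconst t * \<sigma> i" "\<sigma> i \<noteq> 0"
    and t: "t\<^sup>2 \<noteq> 1"
  shows "antisym_at (Pconst t) i (\<lambda>E. psubst \<sigma> (Poly_Mapping.lookup f E))"
proof -
  let ?s = "transpose i (Suc i)"
  let ?\<rho> = "psubst (\<lambda>j. \<sigma> (?s j))"
  have swap: "?\<rho> (pswap i p) = psubst \<sigma> p" for p
    by (simp add: pswap_def psubst_psubst)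
  have t1: "Pconst (1 - t) \<noteq> 0" and t2: "Pconst (1 - t\<^sup>2) \<noteq> 0"
    using t by auto
  have "psubst \<sigma> (Poly_Mapping.lookup f E) = 0" if E: "i \<notin> E" "Suc i \<notin> E" for E
  proof -
    have "\<sigma> i * Pconst (1 - t\<^sup>2) * psubst \<sigma> (Poly_Mapping.lookup f E) = 0"
      using arg_cong[OF bT_antisymmetric_coeff(1)[OF f E], of ?\<rho>] \<sigma>(1)
      by (simp add: psubst_hom swap Pconst_diff Pconst_mult algebra_simps power2_eq_square)
    then show ?thesis
      using \<sigma>(2) t2 by (simp del: Pconst_eq_0_iff)
  qed
  moreover have "psubst \<sigma> (Poly_Mapping.lookup f E) =
      - Pconst t * psubst \<sigma> (Poly_Mapping.lookup f (?s ` E))" if E: "i \<in> E" "Suc i \<notin> E" for E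
  proof -
    have "\<sigma> i * Pconst (1 - t) * (psubst \<sigma> (Poly_Mapping.lookup f E) +
        Pconst t * psubst \<sigma> (Poly_Mapping.lookup f (?s ` E))) = 0"
      using arg_cong[OF bT_antisymmetric_coeff(2)[OF f E], of ?\<rho>] \<sigma>(1)
      by (simp add: psubst_hom swap Pconst_diff algebra_simps)
    then show ?thesis
      using \<sigma>(2) t1 by (simp add: eq_neg_iff_add_eq_0)
  qed
  ultimately show ?thesis
    by (simp add: antisym_at_def)
qed

text \<open>
  The exchange relations bring two missing indices together without changing whether the
  coefficient vanishes, and a coefficient that misses two adjacent indices is zero.
\<close>

lemma antisym_block_vanish:
  fixes c :: "nat set \<Rightarrow> 'r::idom"
  assumes anti: "\<And>i. a \<le> i \<Longrightarrow> i < N \<Longrightarrow> antisym_at t i c" and t: "t \<noteq> 0"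
  assumes "a \<le> k" "k < l" "l \<le> N" "k \<notin> E" "l \<notin> E"
  shows "c E = 0"
  using assms(3-)
proof (induction "l - k" arbitrary: k E)
  case 0
  then show ?case by simp
next
  case (Suc n)
  have k: "antisym_at t k c"
    using Suc.prems by (intro anti) auto
  show ?case
  proof (cases "Suc k \<in> E")
    case False
    with k Suc.prems show ?thesis
      by (simp add: antisym_at_def)
  next
    case True
    let ?F = "transpose k (Suc k) ` E"
    have F: "k \<in> ?F" "Suc k \<notin> ?F" "l \<notin> ?F"
      using True Suc.prems by (auto simp: image_iff transpose_def split: if_splits)
    have "Suc k \<noteq> l"
      using True Suc.prems by auto
    then have "c ?F = 0"
      using Suc.prems F by (intro Suc.hyps(1)[of "Suc k"] Suc.hyps(2)) (use Suc.hyps(2) in auto)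
    moreover have "c ?F = - t * c E"
      using k F unfolding antisym_at_def by (metis transpose_image_eq_iff)
    ultimately show ?thesis
      using t by simp
  qed
qed

lemma antisym_block_coeff:
  fixes c :: "nat set \<Rightarrow> 'r::idom"
  assumes anti: "\<And>i. a \<le> i \<Longrightarrow> i < N \<Longrightarrow> antisym_at t i c"
  assumes "a \<le> k" "k \<le> N"
  shows "c ({a..N} - {k}) = (- t) ^ (k - a) * c ({a..N} - {a})"
  using assms(2,3)
proof (induction k rule: dec_induct)
  case base
  then show ?case by simp
next
  case (step k)
  have "transpose k (Suc k) ` ({a..N} - {Suc k}) = transpose k (Suc k) ` {a..N} - {k}"
    by (subst image_set_diff) (auto simp: inj_transpose)
  also have "transpose k (Suc k) ` {a..N} = {a..N}"
    using step by (intro permutes_image permutes_swap_id) auto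
  finally have "c ({a..N} - {Suc k}) = - t * c ({a..N} - {k})"
    using anti[of k] step unfolding antisym_at_def by simp
  with step show ?case
    by (simp add: Suc_diff_le)
qed

text \<open>
  An index set of size \<open>N - a\<close> misses at least one element of \<open>{a..N}\<close>, and exactly one
  only if it is \<open>{a..N}\<close> without that element. So on the block \<open>{a..N}\<close> there is only one
  antisymmetric form of this degree, up to a factor.
\<close>

lemma antisym_block_unique:
  fixes c :: "nat set \<Rightarrow> 'k::field pol"
  assumes a: "1 \<le> a" "a \<le> N" and t: "t \<noteq> 0"
    and anti: "\<And>i. a \<le> i \<Longrightarrow> i < N \<Longrightarrow> antisym_at (Pconst t) i c"
    and supp: "\<And>E. c E \<noteq> 0 \<Longrightarrow> finite E \<and> card E = N - a"
  shows "c E = Pconst (Poly_Mapping.lookup (psi N t {a..N}) E) *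
                 (Pconst (inverse (t ^ (a - 1))) * c ({a..N} - {a}))"
proof (cases "\<exists>k\<in>{a..N}. E = {a..N} - {k}")
  case True
  then obtain k where k: "a \<le> k" "k \<le> N" "E = {a..N} - {k}"
    by auto
  have "t ^ (k - 1) * (- 1) ^ (k - a) * inverse (t ^ (a - 1)) = (- t) ^ (k - a)"
  proof -
    have "k - 1 = (a - 1) + (k - a)"
      using k a by simp
    then have "t ^ (k - 1) = t ^ (a - 1) * t ^ (k - a)"
      by (metis power_add)
    then show ?thesis
      using t by (simp add: field_simps power_mult_distrib[symmetric])
  qed
  then have "(- Pconst t) ^ (k - a) =
      Pconst (t ^ (k - 1) * (- 1) ^ (k - a)) * Pconst (inverse (t ^ (a - 1)))"
    by (metis Pconst_mult Pconst_power Pconst_uminus)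
  then show ?thesis
    using antisym_block_coeff[OF anti k(1,2)] lookup_psi_interval(1)[OF a(1) k(1,2), of t] k(3)
    by (simp add: mult.assoc)
next
  case False
  have "c E = 0"
  proof (rule ccontr)
    assume nz: "c E \<noteq> 0"
    then have E: "finite E" "card E = N - a"
      using supp by auto
    have "\<exists>k l. k \<in> {a..N} - E \<and> l \<in> {a..N} - E \<and> k < l"
    proof (rule ccontr)
      assume no: "\<not> ?thesis"
      have "k = l" if "k \<in> {a..N} - E" "l \<in> {a..N} - E" for k l
        using no that by (cases k l rule: linorder_cases) blast+
      then have "card ({a..N} - E) \<le> 1"
        by (simp add: card_le_Suc0_iff_eq)
      moreover have "card {a..N} - card E \<le> card ({a..N} - E)"
        by (rule diff_card_le_card_Diff) (use E in auto)
      ultimately have one: "card ({a..N} - E) = 1"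
        using E a by simp
      then obtain k where k: "{a..N} - E = {k}"
        by (auto simp: card_1_singleton_iff)
      then have "{a..N} - {k} \<subseteq> E" "k \<in> {a..N}"
        by auto
      then have "{a..N} - {k} = E"
        using E by (intro card_subset_eq) (auto simp: card_Diff_singleton)
      with False \<open>k \<in> {a..N}\<close> show False by metis
    qed
    then obtain k l where "a \<le> k" "k < l" "l \<le> N" "k \<notin> E" "l \<notin> E"
      by auto
    from antisym_block_vanish[OF anti _ this] t nz show False
      by simp
  qed
  moreover have "Poly_Mapping.lookup (psi N t {a..N}) E = 0"
    by (rule lookup_psi_interval(2)[OF a(1)]) (use False in blast)
  ultimately show ?thesis by simp
qed

section \<open>The deformed Vandermonde product\<close>

definition tVandermonde :: "nat \<Rightarrow> 'k::comm_ring_1 \<Rightarrow> 'k pol" where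
  "tVandermonde n t = (\<Prod>(i, j)\<in>{(i, j). 1 \<le> i \<and> i < j \<and> j \<le> n}. Pconst t * X i - X j)"

definition rename_vars :: "(nat \<Rightarrow> nat) \<Rightarrow> 'k::comm_ring_1 pol \<Rightarrow> 'k pol" where
  "rename_vars \<pi> = psubst (\<lambda>j. X (\<pi> j))"

lemma rename_vars_comp: "rename_vars \<pi> (rename_vars \<rho> p) = rename_vars (\<pi> \<circ> \<rho>) p"
  by (simp add: rename_vars_def psubst_psubst)

lemma rename_vars_id: "rename_vars id p = p"
  by (simp add: rename_vars_def psubst_ident)

lemma rename_vars_mult: "rename_vars \<pi> (p * r) = rename_vars \<pi> p * rename_vars \<pi> r"
  by (simp add: rename_vars_def psubst_mult)

lemma finite_pairs: "finite {(i, j). 1 \<le> i \<and> i < j \<and> j \<le> (n :: nat)}"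
  by (rule finite_subset[of _ "{1..n} \<times> {1..n}"]) auto

lemma linear_form_neq_0:
  assumes "u \<noteq> 0" "i \<noteq> j"
  shows "Pconst u * X i - Pconst v * X j \<noteq> (0 :: 'k::field pol)"
proof
  assume "Pconst u * X i - Pconst v * X j = 0"
  from arg_cong[OF this, of "psubst (\<lambda>k. if k = i then 1 else 0)"] assms show False
    by (simp add: psubst_hom)
qed

lemma tX_diff_neq_0:
  assumes "t \<noteq> 0" "i \<noteq> j"
  shows "Pconst t * X i - X j \<noteq> (0 :: 'k::field pol)"
  using linear_form_neq_0[OF assms, of 1] by simp

lemma rename_vars_tVandermonde:
  "rename_vars \<pi> (tVandermonde n t) =
     (\<Prod>(i, j)\<in>{(i, j). 1 \<le> i \<and> i < j \<and> j \<le> n}. Pconst t * X (\<pi> i) - X (\<pi> j))"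
  by (simp add: tVandermonde_def rename_vars_def psubst_hom case_prod_unfold)

lemma rename_vars_tVandermonde_neq_0:
  fixes t :: "'k::field"
  assumes "t \<noteq> 0" "inj \<pi>"
  shows "rename_vars \<pi> (tVandermonde n t) \<noteq> 0"
proof -
  have "(case p of (i, j) \<Rightarrow> Pconst t * X (\<pi> i) - X (\<pi> j)) \<noteq> 0"
    if p: "p \<in> {(i, j). 1 \<le> i \<and> i < j \<and> j \<le> n}" for p
  proof (cases p)
    case (Pair i j)
    then have "\<pi> i \<noteq> \<pi> j"
      using p injD[OF assms(2), of i j] by auto
    then show ?thesis
      using Pair tX_diff_neq_0[OF assms(1), of "\<pi> i" "\<pi> j"] by (simp only: prod.case) simp
  qed
  then show ?thesis
    unfolding rename_vars_tVandermonde prod_zero_iff[OF finite_pairs] by blast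
qed

lemma tVandermonde_swap:
  assumes "1 \<le> i" "i < n"
  shows "rename_vars (transpose i (Suc i)) (tVandermonde n t) * (Pconst t * X i - X (Suc i)) =
     tVandermonde n t * (Pconst t * X (Suc i) - X i)"
proof -
  let ?P = "{(i, j). 1 \<le> i \<and> i < j \<and> j \<le> n}" and ?s = "transpose i (Suc i)"
  let ?Q = "?P - {(i, Suc i)}"
  let ?l = "\<lambda>(a, b). Pconst t * X a - X b"
  have mem: "(i, Suc i) \<in> ?P"
    using assms by simp
  have "(\<Prod>(a, b)\<in>?Q. ?l (?s a, ?s b)) = (\<Prod>p\<in>?Q. ?l p)"
    by (rule prod.reindex_bij_witness[where i = "map_prod ?s ?s" and j = "map_prod ?s ?s"])
      (use assms in \<open>auto simp: transpose_def split: if_splits\<close>)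
  moreover have "rename_vars ?s (tVandermonde n t) =
      (Pconst t * X (Suc i) - X i) * (\<Prod>(a, b)\<in>?Q. ?l (?s a, ?s b))"
    unfolding rename_vars_tVandermonde by (subst prod.remove[OF finite_pairs mem]) (simp add: case_prod_unfold)
  moreover have "tVandermonde n t = (Pconst t * X i - X (Suc i)) * (\<Prod>p\<in>?Q. ?l p)"
    unfolding tVandermonde_def by (subst prod.remove[OF finite_pairs mem]) simp
  ultimately show ?thesis
    by (simp add: mult_ac)
qed

text \<open>
  In the fraction field the conclusion says that \<open>g / tVandermonde n t\<close> is symmetric. The
  hypothesis is the same statement for adjacent transpositions, which generate the group.
\<close>

lemma quotient_by_tVandermonde_symmetric:
  fixes t :: "'k::field"
  assumes t: "t \<noteq> 0"
    and adj: "\<And>i. 1 \<le> i \<Longrightarrow> i < n \<Longrightarrow>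
      (X i - Pconst t * X (Suc i)) * g = (X (Suc i) - Pconst t * X i) * pswap i g"
    and \<pi>: "\<pi> permutes {1..n}"
  shows "g * rename_vars \<pi> (tVandermonde n t) = tVandermonde n t * rename_vars \<pi> g"
proof -
  let ?D = "tVandermonde n t"
  define good where
    "good \<pi> \<longleftrightarrow> inj \<pi> \<and> g * rename_vars \<pi> ?D = ?D * rename_vars \<pi> g" for \<pi> :: "nat \<Rightarrow> nat"
  have comp: "good (\<pi> \<circ> \<rho>)" if \<pi>: "good \<pi>" and \<rho>: "good \<rho>" for \<pi> \<rho>
  proof -
    have eq: "g * rename_vars \<rho> ?D = ?D * rename_vars \<rho> g"
      using \<rho> by (simp add: good_def)
    have "rename_vars \<pi> g * rename_vars (\<pi> \<circ> \<rho>) ?D = rename_vars \<pi> ?D * rename_vars (\<pi> \<circ> \<rho>) g"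
      using arg_cong[OF eq, of "rename_vars \<pi>"]
      by (simp add: rename_vars_comp rename_vars_mult)
    moreover have "g * rename_vars \<pi> ?D = ?D * rename_vars \<pi> g"
      using \<pi> by (simp add: good_def)
    ultimately have "rename_vars \<pi> ?D * (g * rename_vars (\<pi> \<circ> \<rho>) ?D) =
        rename_vars \<pi> ?D * (?D * rename_vars (\<pi> \<circ> \<rho>) g)"
      by algebra
    moreover have "rename_vars \<pi> ?D \<noteq> 0"
      using \<pi> t by (simp add: good_def rename_vars_tVandermonde_neq_0)
    ultimately show ?thesis
      using \<pi> \<rho> by (simp add: good_def inj_compose)
  qed
  have adjacent: "good (transpose i (Suc i))" if i: "1 \<le> i" "i < n" for i
  proof -
    let ?l = "Pconst t * X i - X (Suc i)" and ?l' = "Pconst t * X (Suc i) - X i"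
    let ?s = "transpose i (Suc i)"
    have "g * ?l' = ?l * rename_vars ?s g"
      using arg_cong[OF adj[OF i], of uminus] by (simp add: rename_vars_def pswap_def algebra_simps)
    then have "?l * (g * rename_vars ?s ?D) = ?l * (?D * rename_vars ?s g)"
      using tVandermonde_swap[OF i, of t] by algebra
    then show ?thesis
      using tX_diff_neq_0[OF t, of i "Suc i"] by (simp add: good_def inj_transpose)
  qed
  have less: "good (transpose a b)" if "1 \<le> a" "Suc a \<le> b" "b \<le> n" for a b
    using that(2,3)
  proof (induction b rule: dec_induct)
    case base
    then show ?case
      using \<open>1 \<le> a\<close> by (intro adjacent) auto
  next
    case (step k)
    have eq: "transpose a (Suc k) = transpose k (Suc k) \<circ> transpose a k \<circ> transpose k (Suc k)"
      using step by (auto simp: fun_eq_iff transpose_def)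
    have "good (transpose k (Suc k))"
      using step \<open>1 \<le> a\<close> by (intro adjacent) auto
    moreover have "good (transpose a k)"
      using step by simp
    ultimately show ?case
      unfolding eq by (intro comp)
  qed
  have "good \<pi>"
    using \<pi> finite_atLeastAtMost
  proof (induction rule: permutes_induct)
    case id
    show ?case
      unfolding good_def rename_vars_id by (simp add: mult.commute)
  next
    case (swap a b p)
    then have "good (transpose a b)"
      using less[of a b] less[of b a] by (cases a b rule: linorder_cases) (auto simp: transpose_commute)
    with swap show ?case by (intro comp)
  qed
  then show ?thesis
    by (simp add: good_def)
qed

lemma tX_diff_dvd_iff:
  fixes t :: "'k::field"
  assumes "i \<noteq> j"
  shows "Pconst t * X i - X j dvd f \<longleftrightarrow> psubst (X(j := Pconst t * X i)) f = 0"
  using linear_dvd_iff[of "- 1" j "Pconst t * X i" f] assms by (simp add: psubst_hom)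

lemma tX_diff_prime:
  fixes t :: "'k::field"
  assumes "i \<noteq> j"
  shows "prime_elem (Pconst t * X i - X j)"
  using linear_prime[of "- 1" j "Pconst t * X i"] assms X_neq_Pconst_mult_X[of j i t]
  by (simp add: psubst_hom)

lemma Pconst_unit: "d \<noteq> 0 \<Longrightarrow> Pconst d dvd (1 :: 'k::field pol)"
  by (metis Pconst_1 Pconst_mult dvdI right_inverse)

lemma const_mult_X_diff_1:
  fixes d :: "'k::field"
  assumes "d \<noteq> 0"
  shows "Pconst d * X k - 1 = Pconst d * (X k - Pconst (inverse d))"
  using assms by (simp add: right_diff_distrib Pconst_mult[symmetric])

lemma cX_diff_1_dvd_iff:
  fixes d :: "'k::field"
  assumes "d \<noteq> 0"
  shows "Pconst d * X k - 1 dvd f \<longleftrightarrow> psubst (X(k := Pconst (inverse d))) f = 0"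
  unfolding const_mult_X_diff_1[OF assms] by (intro linear_dvd_iff Pconst_unit assms psubst_Pconst)

lemma X_neq_Pconst: "X k \<noteq> (Pconst c :: 'k::field pol)"
proof
  assume *: "X k = (Pconst c :: 'k pol)"
  show False
    using arg_cong[OF *, of "psubst (\<lambda>_. 0)"] arg_cong[OF *, of "psubst (\<lambda>_. 1)"] by simp
qed

lemma cX_diff_1_prime:
  fixes d :: "'k::field"
  assumes "d \<noteq> 0"
  shows "prime_elem (Pconst d * X k - 1)"
  unfolding const_mult_X_diff_1[OF assms]
  by (intro linear_prime Pconst_unit assms psubst_Pconst X_neq_Pconst)

lemma tX_diff_not_dvd:
  fixes t :: "'k::field"
  assumes "t \<noteq> 0" "t\<^sup>2 \<noteq> 1" "i \<noteq> j" "a \<noteq> b" "(a, b) \<noteq> (i, j)"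
  shows "\<not> Pconst t * X i - X j dvd Pconst t * X a - X b"
proof -
  have sq: "Pconst t * (Pconst t * X i) - X i \<noteq> (0 :: 'k pol)"
  proof
    assume "Pconst t * (Pconst t * X i) - X i = (0 :: 'k pol)"
    from arg_cong[OF this, of "psubst (\<lambda>_. 1)"] have "Pconst (t\<^sup>2 - 1) = (0 :: 'k pol)"
      by (simp add: psubst_hom Pconst_diff Pconst_mult power2_eq_square)
    with assms show False by simp
  qed
  have "Pconst t * (Pconst t * X i) - X b \<noteq> (0 :: 'k pol)" if "b \<noteq> i"
    using linear_form_neq_0[of "t * t" i b 1] that assms by (simp add: Pconst_mult mult.assoc)
  moreover have "Pconst t * X a - Pconst t * X i \<noteq> (0 :: 'k pol)" if "a \<noteq> i"
    using linear_form_neq_0[of t a i t] that assms by simp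
  moreover have "Pconst t * X a - X b \<noteq> (0 :: 'k pol)"
    using assms by (intro tX_diff_neq_0)
  ultimately have "psubst (X(j := Pconst t * X i)) (Pconst t * X a - X b) \<noteq> (0 :: 'k pol)"
    using assms sq
    by (cases "a = j"; cases "b = j"; cases "a = i"; cases "b = i")
      (simp_all only: psubst_hom psubst_X psubst_Pconst fun_upd_same fun_upd_other
        prod.inject simp_thms not_False_eq_True)
  then show ?thesis
    using assms by (simp only: tX_diff_dvd_iff simp_thms)
qed

lemma cX_diff_1_not_dvd_tX_diff:
  fixes d :: "'k::field"
  assumes "t \<noteq> 0" "d \<noteq> 0" "i \<noteq> j"
  shows "\<not> Pconst d * X k - 1 dvd Pconst t * X i - X j"
proof -
  have "Pconst t * Pconst (inverse d) \<noteq> X j" "Pconst t * X i \<noteq> Pconst (inverse d)"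
  proof -
    show "Pconst t * Pconst (inverse d) \<noteq> X j"
      using X_neq_Pconst[of j "t * inverse d"] by (metis Pconst_mult)
    show "Pconst t * X i \<noteq> Pconst (inverse d)"
    proof
      assume "Pconst t * X i = Pconst (inverse d)"
      from arg_cong[OF this, of "psubst (\<lambda>_. 0)"] assms show False
        by (simp add: psubst_hom)
    qed
  qed
  moreover have "Pconst t * X i - X j \<noteq> (0 :: 'k pol)"
    using assms by (intro tX_diff_neq_0)
  ultimately show ?thesis
    using assms by (auto simp: cX_diff_1_dvd_iff psubst_hom)
qed

lemma cX_diff_1_not_dvd_cX_diff_1:
  fixes d :: "'k::field"
  assumes "d \<noteq> 0" "k \<noteq> l"
  shows "\<not> Pconst d * X k - 1 dvd Pconst d * X l - 1"
proof
  assume "Pconst d * X k - 1 dvd Pconst d * X l - 1"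
  then have "Pconst d * X l - 1 = (0 :: 'k pol)"
    using assms by (simp add: cX_diff_1_dvd_iff psubst_hom)
  from arg_cong[OF this, of "psubst (\<lambda>_. 0)"] show False
    by (simp add: psubst_hom)
qed

text \<open>
  The Vandermonde factor \<open>tX\<^sub>i - X\<^sub>j\<close> divides \<open>g\<close> because it does not divide the
  image of the product under \<open>(i j)\<close>, where the pair \<open>i, j\<close> contributes
  \<open>tX\<^sub>j - X\<^sub>i\<close> instead.
  The factor \<open>dX\<^sub>n - 1\<close> divides \<open>g\<close> by hypothesis, and symmetry
  carries this over to the other variables.
\<close>

lemma tVandermonde_mult_linear_dvd:
  fixes t d :: "'k::field"
  assumes t: "t \<noteq> 0" "t\<^sup>2 \<noteq> 1" and d: "d \<noteq> 0"
    and sym: "\<And>\<pi>. \<pi> permutes {1..n} \<Longrightarrow>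
      g * rename_vars \<pi> (tVandermonde n t) = tVandermonde n t * rename_vars \<pi> g"
    and vanish: "1 \<le> n \<Longrightarrow> psubst (X(n := Pconst (inverse d))) g = 0"
  shows "tVandermonde n t * (\<Prod>k=1..n. Pconst d * X k - 1) dvd g"
proof (rule mult_prod_dvdI)
  have "1 * tVandermonde n t dvd g"
    unfolding tVandermonde_def
  proof (rule mult_prod_dvdI[OF finite_pairs], goal_cases)
    case (3 p)
    then obtain i j where p: "p = (i, j)" "1 \<le> i" "i < j" "j \<le> n"
      by auto
    let ?l = "Pconst t * X i - X j :: 'k pol" and ?s = "transpose i j"
    have prime: "prime_elem ?l"
      using p by (intro tX_diff_prime) auto
    have "?l dvd tVandermonde n t"
      unfolding tVandermonde_def using p by (intro dvd_prod_eqI[OF finite_pairs, of "(i, j)"]) auto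
    then have "?l dvd g * rename_vars ?s (tVandermonde n t)"
      using sym[OF permutes_swap_id] p by simp
    moreover have "\<not> ?l dvd rename_vars ?s (tVandermonde n t)"
    proof
      assume "?l dvd rename_vars ?s (tVandermonde n t)"
      then obtain a b where ab: "a < b" "?l dvd Pconst t * X (?s a) - X (?s b)"
        unfolding rename_vars_tVandermonde by (auto dest!: prime_elem_dvd_prodD[OF prime])
      moreover have "?s a \<noteq> ?s b"
        using ab(1) inj_eq[OF inj_transpose, of i j a b] by (metis less_irrefl)
      ultimately have "(?s a, ?s b) = (i, j)"
        using tX_diff_not_dvd[OF t, of i j "?s a" "?s b"] p by blast
      then have "a = j" "b = i"
        by (auto simp: transpose_def split: if_splits)
      with ab p show False by simp
    qed
    ultimately show ?case
      using p by (simp add: prime_elem_dvd_mult_iff[OF prime])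
  next
    case (4 p)
    then show ?case
      by (auto simp: tX_diff_dvd_iff)
  next
    case (5 p p')
    then obtain i j a b where "p = (i, j)" "p' = (a, b)" "i < j" "a < b" "(a, b) \<noteq> (i, j)"
      by auto
    then show ?case
      using tX_diff_not_dvd[OF t, of i j a b] by simp
  qed (auto intro: tX_diff_prime)
  then show "tVandermonde n t dvd g" by simp
  have not_dvd: "\<not> Pconst d * X k - 1 dvd rename_vars \<pi> (tVandermonde n t)" if "inj \<pi>" for k \<pi>
  proof
    assume "Pconst d * X k - 1 dvd rename_vars \<pi> (tVandermonde n t)"
    then obtain a b where "a < b" "Pconst d * X k - 1 dvd Pconst t * X (\<pi> a) - X (\<pi> b)"
      unfolding rename_vars_tVandermonde by (auto dest!: prime_elem_dvd_prodD[OF cX_diff_1_prime[OF d]])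
    with cX_diff_1_not_dvd_tX_diff[OF t(1) d, of "\<pi> a" "\<pi> b" k] injD[OF that, of a b] show False
      by auto
  qed
  show "\<not> Pconst d * X k - 1 dvd tVandermonde n t" for k
    using not_dvd[of id k] by (simp add: rename_vars_id)
  show "Pconst d * X k - 1 dvd g" if k: "k \<in> {1..n}" for k
  proof -
    let ?s = "transpose k n"
    have "Pconst d * X n - 1 dvd g"
      using vanish k d by (simp add: cX_diff_1_dvd_iff)
    then have "rename_vars ?s (Pconst d * X n - 1) dvd rename_vars ?s g"
      by (auto simp: dvd_def rename_vars_mult)
    then have "Pconst d * X k - 1 dvd rename_vars ?s g"
      by (simp add: rename_vars_def psubst_hom)
    then have "Pconst d * X k - 1 dvd g * rename_vars ?s (tVandermonde n t)"
      using sym[OF permutes_swap_id, of k n] k by simp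
    then show ?thesis
      using not_dvd[of ?s k] by (simp add: prime_elem_dvd_mult_iff[OF cX_diff_1_prime[OF d]] inj_transpose)
  qed
qed (use d in \<open>auto intro: cX_diff_1_prime simp: cX_diff_1_not_dvd_cX_diff_1\<close>)

text \<open>
  The product of the \<open>dX\<^sub>k - 1\<close> is symmetric, so the cofactor is as symmetric as
  \<open>g / tVandermonde n t\<close>.
\<close>

lemma symmetric_cofactor:
  fixes t d :: "'k::field"
  assumes t: "t \<noteq> 0" "t\<^sup>2 \<noteq> 1" and d: "d \<noteq> 0"
    and g: "pol_in {1..n} g"
    and adj: "\<And>i. 1 \<le> i \<Longrightarrow> i < n \<Longrightarrow>
      (X i - Pconst t * X (Suc i)) * g = (X (Suc i) - Pconst t * X i) * pswap i g"
    and vanish: "1 \<le> n \<Longrightarrow> psubst (X(n := Pconst (inverse d))) g = 0"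
  obtains h where "pol_in {1..n} h" "sympol n h"
    "g = tVandermonde n t * (\<Prod>k=1..n. Pconst d * X k - 1) * h"
proof -
  let ?D = "tVandermonde n t" and ?L = "\<Prod>k=1..n. Pconst d * X k - 1"
  note sym = quotient_by_tVandermonde_symmetric[OF t(1) adj]
  from tVandermonde_mult_linear_dvd[OF t d sym vanish] obtain h where h: "g = ?D * ?L * h"
    by (auto simp: dvd_def)
  have D: "?D \<noteq> 0"
    using rename_vars_tVandermonde_neq_0[OF t(1), of id n] by (simp add: rename_vars_id)
  have L: "?L \<noteq> 0"
    using d by (auto simp: const_mult_X_diff_1 X_neq_Pconst)
  have pol: "pol_in {1..n} (?D * ?L)"
    unfolding tVandermonde_def
    by (intro pol_in_mult pol_in_prod)
      (auto intro!: pol_in_diff pol_in_mult pol_in_X)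
  \<comment> \<open>Killing the variables outside \<open>{1..n}\<close> fixes \<open>g\<close> and the divisor, hence the quotient.\<close>
  let ?r = "psubst (\<lambda>j. if j \<in> {1..n} then X j else 0)"
  have rg: "?r g = g" and rDL: "?r (?D * ?L) = ?D * ?L"
    by (rule psubst_id_on[OF g], simp) (rule psubst_id_on[OF pol], simp)
  have "?D * ?L * ?r h = ?r (?D * ?L) * ?r h"
    by (simp only: rDL)
  also have "\<dots> = ?r (?D * ?L * h)"
    by (simp only: psubst_mult)
  also have "\<dots> = ?D * ?L * h"
    unfolding h[symmetric] by (rule rg)
  finally have r: "?r h = h"
    using D L by simp
  have h_in: "pol_in {1..n} (?r h)"
    by (rule pol_in_psubst[of UNIV]) (auto simp: pol_in_def[of UNIV] pol_in_X)
  have "rename_vars \<pi> h = h" if \<pi>: "\<pi> permutes {1..n}" for \<pi>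
  proof -
    have "rename_vars \<pi> ?L = (\<Prod>k=1..n. Pconst d * X (\<pi> k) - 1)"
      by (simp add: rename_vars_def psubst_hom)
    also have "\<dots> = ?L"
      by (subst (2) prod.permute[OF \<pi>]) simp
    finally have "rename_vars \<pi> g = rename_vars \<pi> ?D * ?L * rename_vars \<pi> h"
      by (subst h) (simp only: rename_vars_mult)
    then have "?D * rename_vars \<pi> ?D * ?L * rename_vars \<pi> h =
        ?D * rename_vars \<pi> ?D * ?L * h"
      using sym[OF _ _ \<pi>] h by algebra
    then show ?thesis
      using D L rename_vars_tVandermonde_neq_0[OF t(1) permutes_inj[OF \<pi>], of n] by simp
  qed
  then have "sympol n h"
    by (simp add: sympol_def rename_vars_def)
  with h h_in r show ?thesis
    by (intro that[of h]) simp_all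
qed

section \<open>Evaluation at the special point\<close>

lemma P_space_coeff:
  assumes "v \<in> P_space N m"
  shows "Poly_Mapping.lookup v E \<noteq> 0 \<Longrightarrow> E \<subseteq> {1..N} \<and> card E = m"
proof -
  let ?S = "{v. \<forall>E. Poly_Mapping.lookup v E \<noteq> 0 \<longrightarrow> E \<subseteq> {1..N} \<and> card E = m}"
  have "ferm.span {phi E | E. E \<subseteq> {1..N} \<and> card E = m} \<subseteq> (?S :: 'a ferm set)"
  proof (rule ferm.span_minimal)
    show "ferm.subspace (?S :: 'a ferm set)"
      unfolding ferm.subspace_def
    proof (intro conjI ballI allI)
      show "v + w \<in> ?S" if "v \<in> ?S" "w \<in> ?S" for v w :: "'a ferm"
      proof -
        have "Poly_Mapping.lookup v E \<noteq> 0 \<or> Poly_Mapping.lookup w E \<noteq> 0"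
          if "Poly_Mapping.lookup (v + w) E \<noteq> 0" for E
          using that by (auto simp: lookup_add)
        then show ?thesis
          using that by blast
      qed
    qed (simp_all add: lookup_smul)
  qed (auto simp: lookup_phi split: if_splits)
  then have "v \<in> ?S"
    using assms unfolding P_space_def by blast
  then show "Poly_Mapping.lookup v E \<noteq> 0 \<Longrightarrow> E \<subseteq> {1..N} \<and> card E = m"
    by blast
qed

lemma lookup_tensor: "Poly_Mapping.lookup (tensor p v) E = Pconst (Poly_Mapping.lookup v E) * p"
  by (simp add: tensor_def lookup_map)

lemma subspace_sP0: "super.subspace (sP0_space N m t)"
  by (simp add: sP0_space_def)

lemma sP0_space_coeff:
  fixes f :: "'k::field super"
  assumes "f \<in> sP0_space N m t"
  shows "pol_in {1..N} (Poly_Mapping.lookup f E)"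
    and "Poly_Mapping.lookup f E \<noteq> 0 \<Longrightarrow> E \<subseteq> {1..N} \<and> card E = m"
proof -
  let ?S = "{f. \<forall>E. pol_in {1..N} (Poly_Mapping.lookup f E) \<and>
    (Poly_Mapping.lookup f E \<noteq> 0 \<longrightarrow> E \<subseteq> {1..N} \<and> card E = m)}"
  have "sP0_space N m t \<subseteq> (?S :: 'k super set)"
    unfolding sP0_space_def
  proof (rule super.span_minimal)
    show "super.subspace (?S :: 'k super set)"
      unfolding super.subspace_def
    proof (intro conjI ballI allI)
      show "f + g \<in> ?S" if "f \<in> ?S" "g \<in> ?S" for f g
      proof -
        have "Poly_Mapping.lookup f E \<noteq> 0 \<or> Poly_Mapping.lookup g E \<noteq> 0"
          if "Poly_Mapping.lookup (f + g) E \<noteq> 0" for E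
          using that by (auto simp: lookup_add)
        moreover have "pol_in {1..N} (Poly_Mapping.lookup (f + g) E)" for E
          using that by (simp add: lookup_add pol_in_add)
        ultimately show ?thesis
          using that by blast
      qed
      show "ksmul c f \<in> ?S" if "f \<in> ?S" for c f
      proof -
        have "Poly_Mapping.lookup f E \<noteq> 0" if "Poly_Mapping.lookup (ksmul c f) E \<noteq> 0" for E
          using that by (auto simp: ksmul_def lookup_smul)
        moreover have "pol_in {1..N} (Poly_Mapping.lookup (ksmul c f) E)" for E
          using that by (simp add: ksmul_def lookup_smul pol_in_mult)
        ultimately show ?thesis
          using that by blast
      qed
    qed simp
    show "{tensor p v | p v. pol_in {1..N} p \<and> v \<in> P0_space N m t} \<subseteq> ?S"
    proof clarify
      fix p :: "'k pol" and v E
      assume p: "pol_in {1..N} p" and v: "v \<in> P0_space N m t"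
      have "E \<subseteq> {1..N} \<and> card E = m" if "Poly_Mapping.lookup (tensor p v) E \<noteq> 0"
        by (rule P_space_coeff[of v]) (use v that in \<open>auto simp: lookup_tensor P0_space_def\<close>)
      moreover have "pol_in {1..N} (Poly_Mapping.lookup (tensor p v) E)"
        using p by (simp add: lookup_tensor pol_in_mult)
      ultimately show "pol_in {1..N} (Poly_Mapping.lookup (tensor p v) E) \<and>
          (Poly_Mapping.lookup (tensor p v) E \<noteq> 0 \<longrightarrow> E \<subseteq> {1..N} \<and> card E = m)"
        by blast
    qed
  qed
  with assms have "f \<in> ?S"
    by blast
  then show "pol_in {1..N} (Poly_Mapping.lookup f E)"
    and "Poly_Mapping.lookup f E \<noteq> 0 \<Longrightarrow> E \<subseteq> {1..N} \<and> card E = m"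
    by blast+
qed

text \<open>The set \<open>{N - m..N}\<close> has no inversions, so there is no lower term in its triangularity condition.\<close>

lemma tau_interval_eq_psi:
  fixes t :: "'k::field"
  assumes "is_tau N m t {N - m..N} v"
  shows "v = psi N t {N - m..N}"
proof -
  have "{(i, j). i \<in> {N - m..N} \<and> j \<in> {1..N} - {N - m..N} \<and> i < j} = {}"
    by auto
  then have "inv_num N {N - m..N} = 0"
    unfolding inv_num_def by (metis card.empty)
  then have "v - smul 1 (psi N t {N - m..N}) \<in> ferm.span {}"
    using assms by (simp add: is_tau_def)
  then show ?thesis
    by (simp add: ferm.span_empty)
qed

lemma alg_independent2_nonroot:
  fixes q t :: "'k::field_char_0"
  assumes "alg_independent2 q t"
  shows "t \<noteq> 0" "t\<^sup>2 \<noteq> 1"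
proof -
  have *: "poly (map_poly (\<lambda>p. poly (map_poly of_rat p) q) P) t = 0 \<Longrightarrow> P = 0" for P
    using assms by (simp add: alg_independent2_def)
  show "t \<noteq> 0"
    using *[of "[:0, 1:]"] by (auto simp: map_poly_pCons)
  have "map_poly of_rat (- 1) = (- 1 :: 'k poly)"
    by (rule poly_eqI) (simp add: coeff_map_poly of_rat_minus)
  then show "t\<^sup>2 \<noteq> 1"
    using *[of "[:- 1, 0, 1:]"] by (auto simp: map_poly_pCons power2_eq_square)
qed

lemma antisymmetric_at_special_point:
  fixes f :: "'k::field super"
  assumes m: "m < N" and t: "t \<noteq> 0" "t\<^sup>2 \<noteq> 1"
    and f: "f \<in> sP0_space N m t"
    and anti: "\<And>i. 1 \<le> i \<Longrightarrow> i < N \<Longrightarrow> bT t i f = - f"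
  obtains h where "pol_in {1..N - m - 1} h" "sympol (N - m - 1) h"
    "ssubst (special_point N m t) f =
       tensor (tVandermonde (N - m - 1) t *
         (\<Prod>k=1..N - m - 1. Pconst (t ^ (m + 1)) * X k - 1) * h) (psi N t {N - m..N})"
proof -
  define n where "n = N - m - 1"
  define a where "a = N - m"
  have a: "a = Suc n" "1 \<le> a" "a \<le> N" "m = N - a"
    using m by (auto simp: a_def n_def)
  let ?\<sigma> = "special_point N m t :: nat \<Rightarrow> 'k pol"
  have \<sigma>_var: "?\<sigma> i = X i" if "i \<le> n" for i
    using that by (simp add: special_point_def n_def)
  have \<sigma>_const: "?\<sigma> i = Pconst (inverse t ^ (N - i))" if "n < i" for i
    using that by (simp add: special_point_def n_def)
  define c where "c E = psubst ?\<sigma> (Poly_Mapping.lookup f E)" for E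
  define g where "g = Pconst (inverse (t ^ (a - 1))) * c ({a..N} - {a})"
  have inv_step: "Pconst (inverse t ^ (N - Suc i)) = Pconst t * Pconst (inverse t ^ (N - i))"
    if "i < N" for i
  proof -
    have "N - i = Suc (N - Suc i)" using that by simp
    moreover have "t * inverse t ^ Suc k = inverse t ^ k" for k
      using t by (simp add: mult.assoc[symmetric])
    ultimately show ?thesis
      by (simp only: Pconst_mult[symmetric])
  qed
  have form: "c E = Pconst (Poly_Mapping.lookup (psi N t {a..N}) E) * g" for E
    unfolding g_def
  proof (rule antisym_block_unique[OF a(2,3) t(1)])
    show "antisym_at (Pconst t) i c" if i: "a \<le> i" "i < N" for i
      unfolding c_def
    proof (rule antisym_at_value)
      show "?\<sigma> (Suc i) = Pconst t * ?\<sigma> i"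
        using i a \<sigma>_const inv_step[of i] by simp
      show "?\<sigma> i \<noteq> 0"
        using i a(1) t \<sigma>_const[of i] by simp
    qed (use i a t anti in auto)
    show "finite E \<and> card E = N - a" if "c E \<noteq> 0" for E
    proof -
      have "Poly_Mapping.lookup f E \<noteq> 0"
        using that by (auto simp: c_def)
      then show ?thesis
        using sP0_space_coeff(2)[OF f] a(4) by (metis finite_atLeastAtMost finite_subset)
    qed
  qed
  have c_in: "pol_in {1..n} (c E)" for E
    unfolding c_def
  proof (rule pol_in_psubst[OF sP0_space_coeff(1)[OF f]])
    show "pol_in {1..n} (?\<sigma> j)" if "j \<in> {1..N}" for j
      using that by (cases "j \<le> n") (auto simp: \<sigma>_var \<sigma>_const intro: pol_in_X)
  qed
  have g_in: "pol_in {1..n} g"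
    unfolding g_def by (intro pol_in_mult c_in pol_in_Pconst)
  have adj: "(X i - Pconst t * X (Suc i)) * g = (X (Suc i) - Pconst t * X i) * pswap i g"
    if i: "1 \<le> i" "i < n" for i
  proof -
    let ?E = "{a..N} - {a}"
    have "psubst ?\<sigma> (pswap i p) = pswap i (psubst ?\<sigma> p)" for p
    proof -
      have "?\<sigma> (transpose i (Suc i) j) = psubst (\<lambda>j. X (transpose i (Suc i) j)) (?\<sigma> j)" for j
      proof (cases "j \<le> n")
        case True
        then have "transpose i (Suc i) j \<le> n"
          using i by (auto simp: transpose_def)
        with True show ?thesis by (simp add: \<sigma>_var)
      next
        case False
        then have "transpose i (Suc i) j = j"
          using i by (auto simp: transpose_def)
        with False show ?thesis by (simp add: \<sigma>_const)
      qed
      then show ?thesis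
        by (simp add: pswap_def psubst_psubst)
    qed
    moreover have "(X i - Pconst t * X (Suc i)) * Poly_Mapping.lookup f ?E =
        (X (Suc i) - Pconst t * X i) * pswap i (Poly_Mapping.lookup f ?E)"
      by (rule bT_antisymmetric_coeff(1)[OF anti]) (use i a in auto)
    from arg_cong[OF this, of "psubst ?\<sigma>"] calculation i
    have "(X i - Pconst t * X (Suc i)) * c ?E = (X (Suc i) - Pconst t * X i) * pswap i (c ?E)"
      by (simp add: psubst_hom \<sigma>_var c_def)
    then show ?thesis
      unfolding g_def pswap_def by (simp add: psubst_mult mult_ac)
  qed
  \<comment> \<open>If \<open>z\<^sub>n = t\<^bsup>-m-1\<^esup>\<close>, then the block of antisymmetry is \<open>{n..N}\<close>, which has \<open>m + 2\<close> elements.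
    Every index set of size \<open>m\<close> misses two of them.\<close>
  have vanish: "psubst (X(n := Pconst (inverse (t ^ (m + 1))))) g = 0" if n: "1 \<le> n"
  proof -
    let ?r = "psubst (X(n := Pconst (inverse (t ^ (m + 1)))))"
    let ?\<sigma>' = "\<lambda>j. ?r (?\<sigma> j)"
    have \<sigma>': "?\<sigma>' i = Pconst (inverse t ^ (N - i))" if "n \<le> i" for i
    proof (cases "i = n")
      case True
      have "N - n = m + 1"
        using a by simp
      with True show ?thesis
        using \<sigma>_var[of n] by (simp add: power_inverse)
    next
      case False
      with that show ?thesis by (simp add: \<sigma>_const)
    qed
    have "psubst ?\<sigma>' (Poly_Mapping.lookup f ({a..N} - {a})) = 0"
    proof (rule antisym_block_vanish[of n N "Pconst t" "\<lambda>E. psubst ?\<sigma>' (Poly_Mapping.lookup f E)" n a])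
      show "antisym_at (Pconst t) i (\<lambda>E. psubst ?\<sigma>' (Poly_Mapping.lookup f E))"
        if i: "n \<le> i" "i < N" for i
      proof (rule antisym_at_value)
        show "?\<sigma>' (Suc i) = Pconst t * ?\<sigma>' i"
          using i \<sigma>'[of i] \<sigma>'[of "Suc i"] inv_step[of i] by simp
        show "?\<sigma>' i \<noteq> 0"
          using i t \<sigma>'[of i] by simp
      qed (use i n t anti in auto)
    qed (use a t in auto)
    then show ?thesis
      by (simp add: g_def c_def psubst_mult psubst_psubst)
  qed
  have "t ^ (m + 1) \<noteq> 0"
    using t by simp
  from symmetric_cofactor[OF t this g_in adj vanish] obtain h where h:
    "pol_in {1..n} h" "sympol n h"
    "g = tVandermonde n t * (\<Prod>k=1..n. Pconst (t ^ (m + 1)) * X k - 1) * h"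
    by blast
  have "ssubst ?\<sigma> f = tensor g (psi N t {a..N})"
    by (rule poly_mapping_eqI) (simp add: ssubst_def lookup_map lookup_tensor form[unfolded c_def])
  with h show ?thesis
    by (intro that[of h]) (simp_all add: n_def a_def)
qed

theorem mainTheorem6:
  fixes N m :: nat and q t :: "'k::field_char_0"
    and \<tau> :: "nat set \<Rightarrow> 'k ferm"
    and M :: "(nat \<Rightarrow>\<^sub>0 nat) \<Rightarrow> nat set \<Rightarrow> 'k super"
    and lam :: "nat \<Rightarrow>\<^sub>0 nat" and E :: "nat set" and pa :: "'k super"
  assumes "N \<ge> 2" and "m \<le> N - 1"
    and "alg_independent2 q t"
    and "\<And>F. F \<in> Y0 N m \<Longrightarrow> is_tau N m t F (\<tau> F)"
    and "\<And>\<alpha> F. \<alpha> \<in> compositions N \<Longrightarrow> F \<in> Y0 N m \<Longrightarrow> is_macdonald N m q t \<tau> \<alpha> F (M \<alpha> F)"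
    and "lam \<in> dec_compositions N" and "E \<in> Y0 N m"
    and "row_strict N m (tab_label N m lam E)"
    and "is_antisym_macdonald N m t M lam E pa"
  shows "\<exists>p0 :: 'k pol. pol_in {1..N - m - 1} p0 \<and> sympol (N - m - 1) p0 \<and>
    ssubst (special_point N m t) pa =
      tensor
        ((\<Prod>(i, j)\<in>{(i, j). 1 \<le> i \<and> i < j \<and> j \<le> N - m - 1}. Pconst t * X i - X j)
          * (\<Prod>k=1..N - m - 1. Pconst (t ^ (m + 1)) * X k - 1)
          * p0)
        (\<tau> {N - m..N})"
proof -
  have m: "m < N"
    using assms(1,2) by linarith
  note t = alg_independent2_nonroot[OF assms(3)]
  have "M_basis N m M lam E \<subseteq> sP0_space N m t"
    using assms(5) by (auto simp: M_basis_def is_macdonald_def)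
  then have "super.span (M_basis N m M lam E) \<subseteq> sP0_space N m t"
    by (rule super.span_minimal) (rule subspace_sP0)
  then have pa: "pa \<in> sP0_space N m t" and anti: "\<And>i. 1 \<le> i \<Longrightarrow> i < N \<Longrightarrow> bT t i pa = - pa"
    using assms(9) by (auto simp: is_antisym_macdonald_def)
  have "{N - m..N} \<in> Y0 N m"
    using m by (auto simp: Y0_def)
  then have tau: "\<tau> {N - m..N} = psi N t {N - m..N}"
    by (intro tau_interval_eq_psi assms(4))
  from antisymmetric_at_special_point[OF m t pa anti] obtain h where
    "pol_in {1..N - m - 1} h" "sympol (N - m - 1) h"
    "ssubst (special_point N m t) pa =
       tensor (tVandermonde (N - m - 1) t *
         (\<Prod>k=1..N - m - 1. Pconst (t ^ (m + 1)) * X k - 1) * h) (psi N t {N - m..N})"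
    by blast
  then show ?thesis
    unfolding tau tVandermonde_def by blast
qed

end
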